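(* The partial order $\langle\mathcal P(\kappa),\subset_{\mathrm{NS}(\omega)}\rangle$ can be embedded into $\langle\mathcal E^B_\kappa,\le_B\rangle$. In particular, $\langle\mathcal P(\omega_1),\subset_{\mathrm{NS}}\rangle$ can be embedded into $\langle\mathcal E^B_{\omega_1},\le_B\rangle$ assuming CH.
   Context: Throughout, $\kappa$ is an uncountable regular cardinal with $\kappa^{<\kappa}=\kappa$ (i.e. $|\kappa^\alpha|=\kappa$ for all $0<\alpha<\kappa$). The space $2^\kappa$ of all functions $\kappa\to\{0,1\}$ carries the topology generated by the sets $N_p=\{\eta\in 2^\kappa\mid \eta\restriction\alpha=p\}$ for $\alpha<\kappa$, $p\in 2^\alpha$. Borel sets are obtained by closing the topology under unions and intersections of length $\le\kappa$ and complements (likewise for $(2^\kappa)^2$ with the product topology). A function is Borel if inverse images of open sets are Borel. For equivalence relations $E,E'$ on $2^\kappa$, $E\le_B E'$ means that there is a Borel function $f\colon 2^\kappa\to2^\kappa$ with $(\eta,\xi)\in E\iff(f(\eta),f(\xi))\in E'$ for all $\eta,\xi$. $\mathcal E^B_\kappa$ is the set of equivalence relations on $2^\kappa$ that are Borel subsets of $(2^\kappa)^2$. A set $C\subset\kappa$ is $\omega$-closed if for every increasing sequence $\langle\alpha_i\in C\mid i<\omega\rangle$ the limit $\sup_{i<\omega}\alpha_i$ is in $C$; it is $\omega$-cub if it is $\omega$-closed and unbounded in $\kappa$. A set is $\omega$-stationary if it intersects every $\omega$-cub set. $X\subset_{\mathrm{NS}(\omega)}Y$ means that $X\setminus Y$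 is not $\omega$-stationary; $X\subset_{\mathrm{NS}}Y$ means that $X\setminus Y$ is non-stationary. These relations and $\le_B$ are quasiorders, regarded as partial orders modulo the induced equivalence relations; an embedding of $\langle\mathcal P(\kappa),\preceq\rangle$ into $\langle\mathcal E^B_\kappa,\le_B\rangle$ is a map $F\colon\mathcal P(\kappa)\to\mathcal E^B_\kappa$ with $X\preceq Y\iff F(X)\le_B F(Y)$ for all $X,Y\subset\kappa$. *)

theory Defs
  imports "HOL-Analysis.Analysis"
begin

unbundle cardinal_syntax

text \<open>
  The cardinal \<open>\<kappa>\<close> is the well-order of a type \<open>'k\<close>: its elements are the ordinals below
  \<open>\<kappa>\<close>, and \<open>{..<a}\<close> is the ordinal \<open>a\<close> as a set. That this order is a cardinal
  (and regular, uncountable, ...) is expressed through the relation \<open>ord_rel\<close>. Subsets of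
  \<open>\<kappa>\<close> are the elements of \<open>'k set\<close>, and \<open>2\<^sup>\<kappa>\<close> is the type \<open>'k \<Rightarrow> bool\<close>.
\<close>

definition ord_rel :: "'k::wellorder rel" where
  "ord_rel = {(x, y). x \<le> y}"

definition small_powers_eq :: "'k::wellorder itself \<Rightarrow> bool" where
  "small_powers_eq _ \<longleftrightarrow>
     (\<forall>a::'k. {..<a} \<noteq> {} \<longrightarrow> (ord_rel :: 'k rel) ^c |{..<a}| =o (ord_rel :: 'k rel))"

definition continuum_hypothesis :: bool where
  "continuum_hypothesis \<longleftrightarrow> ctwo ^c natLeq =o cardSuc natLeq"


text \<open>This is not the product topology that the library puts on \<open>'k \<Rightarrow> bool\<close>.\<close>

definition basic_open :: "'k::wellorder \<Rightarrow> ('k \<Rightarrow> bool) \<Rightarrow> ('k \<Rightarrow> bool) set" where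
  "basic_open a p = {\<eta>. restrict \<eta> {..<a} = p}"

definition cantor_topology :: "('k::wellorder \<Rightarrow> bool) topology" where
  "cantor_topology =
     topology_generated_by {basic_open a p | a p. p \<in> {..<a} \<rightarrow>\<^sub>E (UNIV :: bool set)}"

text \<open>
  Borel sets of a space \<open>X\<close> with respect to a cardinal \<open>r\<close>: unions and intersections
  are over families of size at most \<open>r\<close>.
\<close>

inductive_set borel_sets_of :: "'i rel \<Rightarrow> 'a topology \<Rightarrow> 'a set set"
  for r :: "'i rel" and X :: "'a topology" where
  open_set: "openin X U \<Longrightarrow> U \<in> borel_sets_of r X"
| union: "(\<forall>A\<in>\<A>. A \<in> borel_sets_of r X) \<Longrightarrow> |\<A>| \<le>o r \<Longrightarrow> \<Union>\<A> \<in> borel_sets_of r X"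
| inter: "(\<forall>A\<in>\<A>. A \<in> borel_sets_of r X) \<Longrightarrow> |\<A>| \<le>o r \<Longrightarrow> \<A> \<noteq> {} \<Longrightarrow>
    \<Inter>\<A> \<in> borel_sets_of r X"
| compl: "A \<in> borel_sets_of r X \<Longrightarrow> topspace X - A \<in> borel_sets_of r X"

definition borel_function :: "(('k::wellorder \<Rightarrow> bool) \<Rightarrow> ('k \<Rightarrow> bool)) \<Rightarrow> bool" where
  "borel_function f \<longleftrightarrow>
     (\<forall>U. openin cantor_topology U \<longrightarrow> f -` U \<in> borel_sets_of (ord_rel :: 'k rel) cantor_topology)"

definition borel_reducible ::
    "('k::wellorder \<Rightarrow> bool) rel \<Rightarrow> ('k \<Rightarrow> bool) rel \<Rightarrow> bool" where
  "borel_reducible E E' \<longleftrightarrow>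
     (\<exists>f. borel_function f \<and> (\<forall>\<eta> \<xi>. (\<eta>, \<xi>) \<in> E \<longleftrightarrow> (f \<eta>, f \<xi>) \<in> E'))"

definition borel_equivs :: "('k::wellorder \<Rightarrow> bool) rel set" where
  "borel_equivs =
     {E. equiv UNIV E \<and>
         E \<in> borel_sets_of (ord_rel :: 'k rel) (prod_topology cantor_topology cantor_topology)}"


definition unbounded :: "'k::wellorder set \<Rightarrow> bool" where
  "unbounded C \<longleftrightarrow> (\<forall>a. \<exists>c\<in>C. a < c)"

text \<open>
  Suprema are least upper bounds. For uncountable regular \<open>\<kappa>\<close> every \<open>\<omega>\<close>-sequence
  is bounded, so the \<open>LEAST\<close> below is well-defined.
\<close>

definition omega_closed :: "'k::wellorder set \<Rightarrow> bool" where
  "omega_closed C \<longleftrightarrow>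
     (\<forall>\<alpha> :: nat \<Rightarrow> 'k. strict_mono \<alpha> \<and> range \<alpha> \<subseteq> C \<longrightarrow> (LEAST s. \<forall>i. \<alpha> i \<le> s) \<in> C)"

definition omega_stationary :: "'k::wellorder set \<Rightarrow> bool" where
  "omega_stationary S \<longleftrightarrow> (\<forall>C. omega_closed C \<and> unbounded C \<longrightarrow> S \<inter> C \<noteq> {})"

definition subset_NS_omega :: "'k::wellorder set \<Rightarrow> 'k set \<Rightarrow> bool" where
  "subset_NS_omega X Y \<longleftrightarrow> \<not> omega_stationary (X - Y)"

definition ord_closed :: "'k::wellorder set \<Rightarrow> bool" where
  "ord_closed C \<longleftrightarrow>
     (\<forall>S. S \<subseteq> C \<and> S \<noteq> {} \<and> bdd_above S \<longrightarrow> (LEAST s. \<forall>x\<in>S. x \<le> s) \<in> C)"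

definition stationary :: "'k::wellorder set \<Rightarrow> bool" where
  "stationary S \<longleftrightarrow> (\<forall>C. ord_closed C \<and> unbounded C \<longrightarrow> S \<inter> C \<noteq> {})"

definition subset_NS :: "'k::wellorder set \<Rightarrow> 'k set \<Rightarrow> bool" where
  "subset_NS X Y \<longleftrightarrow> \<not> stationary (X - Y)"


text \<open>
  Embedding of quasiorders, regarded as partial orders modulo the induced equivalences; hence
  no injectivity is required.
\<close>

definition quasiorder_embeds ::
    "'a set \<Rightarrow> ('a \<Rightarrow> 'a \<Rightarrow> bool) \<Rightarrow> 'b set \<Rightarrow> ('b \<Rightarrow> 'b \<Rightarrow> bool) \<Rightarrow> bool" where
  "quasiorder_embeds P le Q le' \<longleftrightarrow>
     (\<exists>F \<in> P \<rightarrow> Q. \<forall>X\<in>P. \<forall>Y\<in>P. le X Y \<longleftrightarrow> le' (F X) (F Y))"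

end

theory Submission
  imports Defs
begin

text \<open>
  Through a bijection \<open>\<kappa> \<times> \<kappa> \<rightarrow> \<kappa>\<close> a point \<open>x\<close> of \<open>2\<^sup>\<kappa>\<close> becomes a \<open>\<kappa>\<close>-sequence of slices
  \<open>x\<^sub>d \<in> 2\<^sup>\<kappa>\<close>. To a set \<open>Y\<close> belongs the relation \<open>E\<^sub>Y\<close> (\<open>embedded_rel Y\<close>): points \<open>x\<close> and \<open>y\<close>
  are equivalent if all their slices are related, \<open>x\<^sub>d Q\<^sub>d y\<^sub>d\<close> for fixed Borel equivalence relations
  \<open>Q\<^sub>d\<close> (\<open>tower d\<close>), and moreover \<open>x\<^sub>d = y\<^sub>d\<close> for all \<open>d < \<beta>\<close> from some point on, for each
  \<open>\<beta> \<in> Y\<close> of cofinality \<open>\<omega>\<close>. The theorem follows from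
    \<open>E\<^sub>Y \<le>\<^sub>B E\<^sub>X\<close> if and only if \<open>X - Y\<close> is not \<open>\<omega>\<close>-stationary
  (\<open>embedded_rel_reducible_iff\<close>) by mapping \<open>X\<close> to the relation of its complement.

  Suppose that an \<open>\<omega>\<close>-cub set \<open>C\<close> misses \<open>X - Y\<close> (\<open>reducible_if_nonstationary\<close>). Then the
  slices are moved to positions in \<open>C\<close>: the slice \<open>x\<^sub>e\<close> is stored inside the slice of the image with
  index the least element of \<open>C\<close> above \<open>e\<close>; this is possible because \<open>Q\<^sub>d\<close> contains the product of
  all \<open>Q\<^sub>e\<close> with \<open>e < d\<close> as a factor. Images can only differ cofinally below \<open>\<beta> \<in> X\<close> if \<open>\<beta>\<close> is a limit
  of \<open>C\<close>, hence in \<open>C\<close>, hence in \<open>Y\<close>, and there the originals do not differ cofinally. The condition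
  at the points of \<open>Y\<close> is stored in the slice with index \<open>0\<close>, as \<open>Q\<^sub>0\<close> is this condition.

  Suppose that \<open>X - Y\<close> is \<open>\<omega>\<close>-stationary and that \<open>f\<close> reduces \<open>E\<^sub>Y\<close> to \<open>E\<^sub>X\<close>
  (\<open>not_reducible_if_stationary\<close>). On a comeager set \<open>f\<close> is continuous. The relations \<open>Q\<^sub>d\<close> are
  constructed by a diagonalization such that \<open>Q\<^sub>d\<close> is not reducible to the product of the \<open>Q\<^sub>e\<close> with
  \<open>e < d\<close>, not even on a comeager set. For this \<open>Q\<^sub>d\<close> has a factor that consists of equality modulo an
  ideal: if the difference of two points codes an element \<open>b\<close> of \<open>2\<^sup>\<kappa>\<close> then it is in the ideal if
  and only if \<open>b\<close> is in a set \<open>P\<^sub>d\<close> (\<open>failure\<close>), and \<open>P\<^sub>d\<close> says that the pair of points coded by \<open>b\<close>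
  violates the relations of index below \<open>d\<close>. Now build generic \<open>x\<close> and \<open>y\<close> that differ in the slice
  \<open>d\<close> only, in a set coding the pair of their own images (\<open>diagonal_pair\<close>). If the images
  agreed in all slices of index at least \<open>d\<close> then \<open>x E\<^sub>Y y\<close> would be equivalent to the negation of
  \<open>f x E\<^sub>X f y\<close>. So a change in the slice \<open>d\<close> can force the images to differ in a slice of index at
  least \<open>d\<close> (\<open>image_slices_differ\<close>). Iterate this along sequences of indices. The ordinals that are
  closed under the sizes of the conditions form an \<open>\<omega>\<close>-cub set, so one of them is some
  \<open>\<beta> \<in> X - Y\<close>. A play of length \<open>\<omega>\<close> whose indices converge to \<open>\<beta>\<close> produces points that
  differ only in slices converging to \<open>\<beta> \<notin> Y\<close> and thus are \<open>E\<^sub>Y\<close>-equivalent, while their images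
  differ cofinally below \<open>\<beta> \<in> X\<close>.

  For \<open>\<kappa> = \<omega>\<^sub>1\<close> the continuum hypothesis gives \<open>\<kappa>\<^sup><\<^sup>\<kappa> = \<kappa>\<close>, and the \<open>\<omega>\<close>-closed sets
  are the closed sets because all smaller ordinals are countable.
\<close>

section \<open>Arithmetic of \<open>\<kappa>\<close>\<close>

lemma Field_ord_rel: "Field (ord_rel :: 'k::wellorder rel) = UNIV"
  by (auto simp: Field_def ord_rel_def)

lemma initial_segment_less:
  assumes "Card_order (ord_rel :: 'k::wellorder rel)"
  shows "|{..<a::'k}| <o (ord_rel :: 'k rel)"
proof -
  have "underS (ord_rel :: 'k rel) a = {..<a}"
    by (auto simp: underS_def ord_rel_def)
  then show ?thesis
    using card_of_underS[OF assms, of a] by (simp add: Field_ord_rel)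
qed

text \<open>
  The assumptions on \<open>\<kappa>\<close>; the parameter only names the type that carries it.
\<close>

locale kappa =
  fixes K :: "'k::wellorder itself"
  assumes card_ord: "card_order (ord_rel :: 'k rel)"
    and uncountable: "natLeq <o (ord_rel :: 'k rel)"
    and regular: "regularCard (ord_rel :: 'k rel)"
    and powers: "small_powers_eq TYPE('k)"
begin

lemma Card_order_ord_rel: "Card_order (ord_rel :: 'k rel)"
  using card_ord by (simp only: Field_ord_rel)

lemma ord_rel_UNIV: "(ord_rel :: 'k rel) =o |UNIV :: 'k set|"
  using card_of_unique[OF card_ord] .

lemma infinite_UNIV_k: "infinite (UNIV :: 'k set)"
proof -
  have "natLeq \<le>o |UNIV :: 'k set|"
    using uncountable ord_rel_UNIV ordLess_imp_ordLeq ordLeq_ordIso_trans by blast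
  then show ?thesis
    by (meson infinite_iff_natLeq_ordLeq)
qed

lemma initial_segment_small: "|{..<a::'k}| <o |UNIV :: 'k set|"
  by (rule ordLess_ordIso_trans[OF initial_segment_less[OF Card_order_ord_rel] ord_rel_UNIV])

lemma no_greatest: "\<exists>b::'k. a < b"
proof (rule ccontr)
  assume "\<not> ?thesis"
  then have *: "UNIV = insert a {..<a}"
    by (auto simp: not_less) (metis order_le_less)
  then obtain h where "bij_betw h (UNIV :: 'k set) (UNIV - {a})"
    using infinite_imp_bij_betw[OF infinite_UNIV_k] by blast
  moreover have "UNIV - {a} = {..<a}" using * by auto
  ultimately have "|UNIV :: 'k set| =o |{..<a}|"
    using card_of_ordIso by metis
  then show False
    using initial_segment_small[of a] by (metis not_ordLess_ordIso ordIso_symmetric)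
qed

text \<open>
  Regularity in the form in which it is used: a family of size less than \<open>\<kappa>\<close> has a strict bound. The
  instances are families indexed by an ordinal below \<open>\<kappa>\<close> and, as \<open>\<kappa>\<close> is uncountable, sequences.
\<close>

lemma small_bounded:
  assumes "|A| <o |UNIV :: 'k set|"
  shows "\<exists>b::'k. \<forall>a\<in>A. f a < b"
proof (rule ccontr)
  assume n: "\<not> ?thesis"
  have "\<exists>y\<in>f ` A. x \<noteq> y \<and> (x, y) \<in> ord_rel" for x
  proof -
    obtain b where "x < b" using no_greatest by blast
    moreover obtain a where "a \<in> A" "\<not> f a < b" using n by blast
    ultimately show ?thesis unfolding ord_rel_def
      by (intro bexI[of _ "f a"]) auto
  qed
  then have "cofinal (f ` A) (ord_rel :: 'k rel)"
    unfolding cofinal_def by blast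
  then have "|f ` A| =o (ord_rel :: 'k rel)"
    using regular unfolding regularCard_def by (simp add: Field_ord_rel)
  then have "|UNIV :: 'k set| \<le>o |A|"
    by (meson card_of_image ord_rel_UNIV ordIso_ordLeq_trans ordIso_symmetric)
  then show False using assms by (simp add: not_ordLess_ordLeq)
qed

lemma bounded_initial: "\<exists>b::'k. \<forall>i<a::'k. f i < b"
  using small_bounded[OF initial_segment_small[of a], of f] by auto

lemma bounded_sequence: "\<exists>b::'k. \<forall>n::nat. f n < b"
proof -
  have "|UNIV :: nat set| <o |UNIV :: 'k set|"
    using uncountable ord_rel_UNIV card_of_nat
    by (meson ordIso_ordLess_trans ordLess_ordIso_trans)
  from small_bounded[OF this, of f] show ?thesis by auto
qed

lemma surjection_if_small:
  assumes "|A| \<le>o (ord_rel :: 'k rel)" "A \<noteq> {}"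
  obtains g :: "'k \<Rightarrow> 'a" where "A = range g"
proof -
  have "|A| \<le>o |UNIV :: 'k set|" using assms(1) ord_rel_UNIV ordLeq_ordIso_trans by blast
  then show ?thesis using assms(2) that by (metis card_of_ordLeq2)
qed

lemma small_range: "|range (g :: 'k \<Rightarrow> 'a)| \<le>o (ord_rel :: 'k rel)"
  by (meson card_of_image ord_rel_UNIV ordIso_symmetric ordLeq_ordIso_trans)

end

text \<open>
  The choice makes sense because \<open>\<kappa> \<times> \<kappa>\<close> has size \<open>\<kappa>\<close>.
\<close>

definition pos :: "'k::wellorder \<times> 'k \<Rightarrow> 'k" where
  "pos = (SOME p. bij p)"

text \<open>
  Three different elements of \<open>\<kappa>\<close>, which serve as names of components.
\<close>

definition ord0 :: "'k::wellorder" where "ord0 = (LEAST x. True)"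
definition ord1 :: "'k::wellorder" where "ord1 = (LEAST x. ord0 < x)"
definition ord2 :: "'k::wellorder" where "ord2 = (LEAST x. ord1 < x)"

lemma ord0_le [simp]: "ord0 \<le> (x::'k::wellorder)"
  unfolding ord0_def by (simp add: Least_le)

lemma not_less_ord0 [simp]: "\<not> x < (ord0::'k::wellorder)"
  by (simp add: not_less)

definition agree :: "'k::wellorder \<Rightarrow> ('k \<Rightarrow> 'v) \<Rightarrow> ('k \<Rightarrow> 'v) \<Rightarrow> bool" where
  "agree a x y \<longleftrightarrow> (\<forall>i<a. x i = y i)"

text \<open>
  An enumeration of a dense set of size \<open>\<kappa>\<close>; the pairs \<open>(a, i)\<close> name the \<open>\<kappa>\<close> many basic open sets,
  which are also the nodes of the tree \<open>2\<^sup><\<^sup>\<kappa>\<close>.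
\<close>

definition dense_points :: "'k::wellorder \<Rightarrow> 'k \<Rightarrow> bool" where
  "dense_points = (SOME g. \<forall>a u. \<exists>i. agree a (g i) u)"

context kappa begin

lemma bij_pos: "bij (pos :: 'k \<times> 'k \<Rightarrow> 'k)"
proof -
  have "|UNIV \<times> UNIV :: ('k \<times> 'k) set| =o |UNIV :: 'k set|"
    using card_of_Times_same_infinite[OF infinite_UNIV_k] .
  then have "\<exists>p :: 'k \<times> 'k \<Rightarrow> 'k. bij p"
    using card_of_ordIso by (metis UNIV_Times_UNIV)
  then show ?thesis unfolding pos_def by (rule someI_ex)
qed

lemma pos_inject [simp]: "pos p = pos q \<longleftrightarrow> p = (q :: 'k \<times> 'k)"
  using bij_pos by (metis bij_pointE)

lemma inv_pos [simp]: "inv pos (pos p) = (p :: 'k \<times> 'k)"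
  using bij_pos by (simp add: bij_is_inj)

lemma pos_inv [simp]: "pos (inv pos i) = (i :: 'k)"
  using bij_pos by (simp add: bij_is_surj surj_f_inv_f)

lemma pos_cases: obtains a b :: 'k where "i = pos (a, b)"
  by (metis pos_inv surj_pair)

lemma ord0_less_ord1: "ord0 < (ord1 :: 'k)"
  unfolding ord1_def using no_greatest by (meson LeastI)

lemma ord1_less_ord2: "ord1 < (ord2 :: 'k)"
  unfolding ord2_def using no_greatest by (meson LeastI)

lemma constants_distinct [simp]:
  "ord1 \<noteq> (ord0 :: 'k)" "ord0 \<noteq> (ord1 :: 'k)" "ord2 \<noteq> (ord0 :: 'k)" "ord2 \<noteq> (ord1 :: 'k)"
  using ord0_less_ord1 ord1_less_ord2 by auto

lemma enumerate_functions_below: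
  obtains g :: "'k \<Rightarrow> 'k \<Rightarrow> 'k" where "\<forall>u. \<exists>i. agree a (g i) u"
proof (cases "{..<a} = {}")
  case True
  then show ?thesis by (intro that[of "\<lambda>i j. i"]) (auto simp: agree_def)
next
  case False
  then have "(ord_rel :: 'k rel) ^c |{..<a}| =o (ord_rel :: 'k rel)"
    using powers unfolding small_powers_eq_def by blast
  then have "|Func {..<a} (UNIV :: 'k set)| \<le>o (ord_rel :: 'k rel)"
    unfolding cexp_def by (simp add: Field_ord_rel Field_card_of ordIso_imp_ordLeq)
  moreover have ne: "restrict u {..<a} \<in> Func {..<a} (UNIV :: 'k set)" for u
    by (auto simp: Func_def)
  ultimately obtain g :: "'k \<Rightarrow> 'k \<Rightarrow> 'k" where g: "Func {..<a} UNIV = range g"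
    by (metis empty_iff surjection_if_small)
  have "\<exists>i. agree a (g i) u" for u
  proof -
    obtain i where "restrict u {..<a} = g i" using ne[of u] g by auto
    then have "agree a (g i) u" unfolding agree_def by (metis lessThan_iff restrict_apply')
    then show ?thesis ..
  qed
  then show ?thesis using that by blast
qed

lemma dense_points: "\<exists>i::'k. agree a (dense_points i) u"
proof -
  have "\<forall>a. \<exists>g :: 'k \<Rightarrow> 'k \<Rightarrow> 'k. \<forall>u. \<exists>i. agree a (g i) u"
    using enumerate_functions_below by metis
  then obtain h :: "'k \<Rightarrow> 'k \<Rightarrow> 'k \<Rightarrow> 'k" where h: "\<forall>a u. \<exists>i. agree a (h a i) u"
    by metis
  define g where "g = (\<lambda>i j. case inv pos i of (a, i') \<Rightarrow> h a i' j = (ord0 :: 'k))"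
  have "\<exists>i. agree a (g i) u" for a u
  proof -
    obtain i where "agree a (h a i) (\<lambda>j. if u j then ord0 else ord1)"
      using h by blast
    then have "agree a (g (pos (a, i))) u" by (auto simp: agree_def g_def)
    then show ?thesis ..
  qed
  then have "\<exists>g :: 'k \<Rightarrow> 'k \<Rightarrow> bool. \<forall>a u. \<exists>i. agree a (g i) u" by blast
  then have "\<forall>a u. \<exists>i. agree a (dense_points i) (u :: 'k \<Rightarrow> bool)"
    unfolding dense_points_def by (rule someI_ex)
  then show ?thesis by blast
qed

text \<open>
  A sequence is a function on an infinite subset of some \<open>b < \<kappa>\<close>, and there are only \<open>\<kappa>\<close> functions
  on \<open>b\<close>. Hence a condition on all sequences is an intersection of \<open>\<kappa>\<close> conditions.
\<close>

lemma enumerate_sequences: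
  obtains s :: "'k \<Rightarrow> nat \<Rightarrow> 'k" where "surj s"
proof -
  obtain e :: "nat \<Rightarrow> 'k" where e: "inj e"
    using infinite_UNIV_k by (meson infinite_countable_subset)
  obtain b where b: "\<forall>n. e n < b" using bounded_sequence by blast
  obtain g :: "'k \<Rightarrow> 'k \<Rightarrow> 'k" where g: "\<forall>u. \<exists>i. agree b (g i) u"
    using enumerate_functions_below by blast
  have "\<exists>i. (\<lambda>n. g i (e n)) = \<sigma>" for \<sigma>
  proof -
    obtain i where "agree b (g i) (\<lambda>j. \<sigma> (inv e j))" using g by blast
    then show ?thesis using b e by (intro exI[of _ i]) (auto simp: agree_def fun_eq_iff)
  qed
  then have "surj (\<lambda>i n. g i (e n))" by (metis surjI surj_def)
  then show ?thesis using that by blast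
qed

end

section \<open>Borel predicates\<close>

lemma agree_refl [simp]: "agree a x x" by (simp add: agree_def)

lemma agree_sym: "agree a x y \<Longrightarrow> agree a y x" by (simp add: agree_def)

lemma agree_trans: "agree a x y \<Longrightarrow> agree a y z \<Longrightarrow> agree a x z" by (simp add: agree_def)

lemma agree_mono: "agree b x y \<Longrightarrow> a \<le> b \<Longrightarrow> agree a x y" by (auto simp: agree_def)

text \<open>
  The basic sets of the same length partition the space, so they form a base and not only a subbase.
\<close>

lemma openin_cantor:
  "openin cantor_topology U \<longleftrightarrow> (\<forall>x\<in>U. \<exists>a. \<forall>y. agree a x y \<longrightarrow> y \<in> (U :: ('k::wellorder \<Rightarrow> bool) set))"
    (is "_ = ?R U")
proof
  have basic: "?R (basic_open a p)" for a :: 'k and p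
  proof
    fix x :: "'k \<Rightarrow> bool" assume x: "x \<in> basic_open a p"
    have "y \<in> basic_open a p" if "agree a x y" for y
    proof -
      have "restrict y {..<a} = restrict x {..<a}"
        using that by (auto simp: agree_def restrict_def fun_eq_iff)
      then show ?thesis using x unfolding basic_open_def by simp
    qed
    then show "\<exists>b. \<forall>y. agree b x y \<longrightarrow> y \<in> basic_open a p" by blast
  qed
  assume "openin cantor_topology U"
  then have "generate_topology_on {basic_open a p | a p. p \<in> {..<a} \<rightarrow>\<^sub>E (UNIV :: bool set)} U"
    unfolding cantor_topology_def by (simp add: openin_topology_generated_by_iff)
  then show "?R U"
  proof induction
    case (Int U V)
    show ?case
    proof
      fix x assume "x \<in> U \<inter> V"
      then have "x \<in> U" "x \<in> V" by auto
      then obtain a b where ab: "\<forall>y. agree a x y \<longrightarrow> y \<in> U" "\<forall>y. agree b x y \<longrightarrow> y \<in> V"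
        using Int.IH by blast
      have "y \<in> U \<inter> V" if "agree (max a b) x y" for y
        using ab agree_mono[OF that, of a] agree_mono[OF that, of b] by simp
      then show "\<exists>a. \<forall>y. agree a x y \<longrightarrow> y \<in> U \<inter> V" by blast
    qed
  next
    case (UN \<U>)
    show ?case
    proof
      fix x assume "x \<in> \<Union>\<U>"
      then obtain V where V: "V \<in> \<U>" "x \<in> V" by blast
      then obtain a where "\<forall>y. agree a x y \<longrightarrow> y \<in> V" using UN.IH by blast
      then show "\<exists>a. \<forall>y. agree a x y \<longrightarrow> y \<in> \<Union>\<U>" using V by blast
    qed
  next
    case (Basis B)
    then obtain a p where "B = basic_open a p" by blast
    then show ?case using basic by simp
  qed simp
next
  assume R: "?R U"
  have U_eq: "U = \<Union>{basic_open a (restrict x {..<a}) | a x. x \<in> U \<and> (\<forall>y. agree a x y \<longrightarrow> y \<in> U)}"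
    (is "_ = \<Union>?B")
  proof (intro set_eqI iffI)
    fix x assume "x \<in> U"
    then obtain a where "\<forall>y. agree a x y \<longrightarrow> y \<in> U" using R by blast
    then have "basic_open a (restrict x {..<a}) \<in> ?B" using \<open>x \<in> U\<close> by blast
    moreover have "x \<in> basic_open a (restrict x {..<a})" by (simp add: basic_open_def)
    ultimately show "x \<in> \<Union>?B" by blast
  next
    fix y assume "y \<in> \<Union>?B"
    then obtain a x where *: "\<forall>y. agree a x y \<longrightarrow> y \<in> U" "restrict y {..<a} = restrict x {..<a}"
      by (auto simp: basic_open_def)
    have "agree a x y" unfolding agree_def
    proof (intro allI impI)
      fix i assume "i < a"
      then show "x i = y i" using fun_cong[OF *(2), of i] by simp
    qed
    then show "y \<in> U" using * by blast
  qed
  have "openin cantor_topology B" if B: "B \<in> ?B" for B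
  proof -
    obtain a x where "B = basic_open a (restrict x {..<a})" using B by blast
    then show ?thesis unfolding cantor_topology_def
      by (intro topology_generated_by_Basis) fastforce
  qed
  then have "openin cantor_topology (\<Union>?B)" by (rule openin_Union)
  then show "openin cantor_topology U" by (simp only: U_eq[symmetric])
qed

lemma topspace_cantor [simp]: "topspace cantor_topology = (UNIV :: ('k::wellorder \<Rightarrow> bool) set)"
  using openin_subset[of cantor_topology UNIV] unfolding openin_cantor by auto

lemma openin_agree: "openin cantor_topology {y :: 'k::wellorder \<Rightarrow> bool. agree a x y}"
  unfolding openin_cantor by (blast intro: agree_trans)

abbreviation cantor_square :: "(('k::wellorder \<Rightarrow> bool) \<times> ('k \<Rightarrow> bool)) topology" where
  "cantor_square \<equiv> prod_topology cantor_topology cantor_topology"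

lemma openin_cantor_square:
  "openin cantor_square U \<longleftrightarrow>
    (\<forall>x y. (x, y) \<in> U \<longrightarrow>
      (\<exists>a. \<forall>x' y'. agree a x x' \<and> agree a y y' \<longrightarrow> (x', y') \<in> (U :: ('k::wellorder \<Rightarrow> bool) rel)))"
    (is "_ = ?R")
proof
  assume U: "openin cantor_square U"
  show ?R
  proof (intro allI impI)
    fix x y assume "(x, y) \<in> U"
    then obtain V W where VW: "openin cantor_topology V" "openin cantor_topology W"
        "x \<in> V" "y \<in> W" "V \<times> W \<subseteq> U"
      using U[unfolded openin_prod_topology_alt, rule_format, OF \<open>(x, y) \<in> U\<close>] by auto
    obtain a where a: "\<forall>z. agree a x z \<longrightarrow> z \<in> V"
      using VW(1,3) unfolding openin_cantor by blast
    obtain b where b: "\<forall>z. agree b y z \<longrightarrow> z \<in> W"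
      using VW(2,4) unfolding openin_cantor by blast
    have "(x', y') \<in> U" if that: "agree (max a b) x x'" "agree (max a b) y y'" for x' y'
    proof -
      have "x' \<in> V" using a agree_mono[OF that(1), of a] by simp
      moreover have "y' \<in> W" using b agree_mono[OF that(2), of b] by simp
      ultimately show ?thesis using VW(5) by blast
    qed
    then show "\<exists>a. \<forall>x' y'. agree a x x' \<and> agree a y y' \<longrightarrow> (x', y') \<in> U" by blast
  qed
next
  assume R: ?R
  show "openin cantor_square U"
    unfolding openin_prod_topology_alt
  proof (intro allI impI)
    fix x y assume "(x, y) \<in> U"
    then obtain a where "\<forall>x' y'. agree a x x' \<and> agree a y y' \<longrightarrow> (x', y') \<in> U"
      using R by blast
    then have "{z. agree a x z} \<times> {z. agree a y z} \<subseteq> U" by blast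
    then show "\<exists>V W. openin cantor_topology V \<and> openin cantor_topology W \<and>
        x \<in> V \<and> y \<in> W \<and> V \<times> W \<subseteq> U"
      using openin_agree[of a x] openin_agree[of a y] agree_refl by blast
  qed
qed

text \<open>
  The second argument only passes the type that carries \<open>\<kappa>\<close>.
\<close>

definition borel_pred :: "'a topology \<Rightarrow> 'k::wellorder itself \<Rightarrow> ('a \<Rightarrow> bool) \<Rightarrow> bool" where
  "borel_pred T k \<phi> \<longleftrightarrow> {x. \<phi> x} \<in> borel_sets_of (ord_rel :: 'k rel) T"

definition bitwise_borel :: "'a topology \<Rightarrow> ('a \<Rightarrow> 'k::wellorder \<Rightarrow> bool) \<Rightarrow> bool" where
  "bitwise_borel T u \<longleftrightarrow> (\<forall>i. borel_pred T TYPE('k) (\<lambda>x. u x i))"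

context kappa begin

context
  fixes T :: "'a topology"
  assumes total: "topspace T = UNIV"
begin

lemma borel_not:
  assumes "borel_pred T TYPE('k) \<phi>"
  shows "borel_pred T TYPE('k) (\<lambda>x. \<not> \<phi> x)"
proof -
  have "topspace T - {x. \<phi> x} \<in> borel_sets_of (ord_rel :: 'k rel) T"
    using assms unfolding borel_pred_def by (rule borel_sets_of.compl)
  moreover have "topspace T - {x. \<phi> x} = {x. \<not> \<phi> x}" using total by auto
  ultimately show ?thesis unfolding borel_pred_def by simp
qed

lemma borel_all:
  assumes "\<And>j::'k. borel_pred T TYPE('k) (\<phi> j)"
  shows "borel_pred T TYPE('k) (\<lambda>x. \<forall>j. \<phi> j x)"
proof -
  have "\<Inter>(range (\<lambda>j. {x. \<phi> j x})) \<in> borel_sets_of (ord_rel :: 'k rel) T"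
    using assms small_range unfolding borel_pred_def
    by (intro borel_sets_of.inter) auto
  moreover have "\<Inter>(range (\<lambda>j. {x. \<phi> j x})) = {x. \<forall>j. \<phi> j x}" by auto
  ultimately show ?thesis unfolding borel_pred_def by simp
qed

lemma borel_ex:
  assumes "\<And>j::'k. borel_pred T TYPE('k) (\<phi> j)"
  shows "borel_pred T TYPE('k) (\<lambda>x. \<exists>j. \<phi> j x)"
proof -
  have "borel_pred T TYPE('k) (\<lambda>x. \<not> (\<forall>j. \<not> \<phi> j x))"
    by (intro borel_not borel_all assms)
  then show ?thesis by simp
qed

lemma borel_const: "borel_pred T TYPE('k) (\<lambda>x. c)"
proof -
  have "{x::'a. c} = UNIV \<or> {x::'a. c} = {}" by auto
  then have "openin T {x. c}" using total by (metis openin_empty openin_topspace)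
  then show ?thesis unfolding borel_pred_def by (rule borel_sets_of.open_set)
qed

lemma borel_conj:
  assumes "borel_pred T TYPE('k) \<phi>" "borel_pred T TYPE('k) \<psi>"
  shows "borel_pred T TYPE('k) (\<lambda>x. \<phi> x \<and> \<psi> x)"
proof -
  have "borel_pred T TYPE('k) (\<lambda>x. \<forall>j::'k. if j = ord0 then \<phi> x else \<psi> x)"
  proof (rule borel_all)
    show "borel_pred T TYPE('k) (\<lambda>x. if j = ord0 then \<phi> x else \<psi> x)" for j :: 'k
      using assms by (cases "j = ord0") simp_all
  qed
  moreover have "(\<forall>j::'k. if j = ord0 then \<phi> x else \<psi> x) \<longleftrightarrow> \<phi> x \<and> \<psi> x" for x
    using constants_distinct(1) by (auto dest: spec[of _ ord0] spec[of _ ord1])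
  ultimately show ?thesis by simp
qed

lemma borel_disj:
  assumes "borel_pred T TYPE('k) \<phi>" "borel_pred T TYPE('k) \<psi>"
  shows "borel_pred T TYPE('k) (\<lambda>x. \<phi> x \<or> \<psi> x)"
proof -
  have "borel_pred T TYPE('k) (\<lambda>x. \<not> (\<not> \<phi> x \<and> \<not> \<psi> x))"
    by (intro borel_not borel_conj assms)
  then show ?thesis by simp
qed

lemma borel_imp:
  assumes "borel_pred T TYPE('k) \<phi>" "borel_pred T TYPE('k) \<psi>"
  shows "borel_pred T TYPE('k) (\<lambda>x. \<phi> x \<longrightarrow> \<psi> x)"
proof -
  have "borel_pred T TYPE('k) (\<lambda>x. \<not> \<phi> x \<or> \<psi> x)"
    by (intro borel_not borel_disj assms)
  then show ?thesis by (simp only: imp_conv_disj)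
qed

lemma borel_iff:
  assumes "borel_pred T TYPE('k) \<phi>" "borel_pred T TYPE('k) \<psi>"
  shows "borel_pred T TYPE('k) (\<lambda>x. \<phi> x = \<psi> x)"
proof -
  have "borel_pred T TYPE('k) (\<lambda>x. (\<phi> x \<longrightarrow> \<psi> x) \<and> (\<psi> x \<longrightarrow> \<phi> x))"
    by (intro borel_conj borel_imp assms)
  then show ?thesis by (simp only: iff_conv_conj_imp)
qed

lemma borel_all_sequences:
  assumes "\<And>\<sigma> :: nat \<Rightarrow> 'k. borel_pred T TYPE('k) (\<phi> \<sigma>)"
  shows "borel_pred T TYPE('k) (\<lambda>x. \<forall>\<sigma>. \<phi> \<sigma> x)"
proof -
  obtain s :: "'k \<Rightarrow> nat \<Rightarrow> 'k" where s: "surj s" by (rule enumerate_sequences)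
  have "(\<forall>\<sigma>. \<phi> \<sigma> x) \<longleftrightarrow> (\<forall>j. \<phi> (s j) x)" for x using s by (metis surjD)
  then show ?thesis using borel_all[of "\<lambda>j. \<phi> (s j)"] assms by simp
qed

text \<open>
  It suffices to know the preimages of open sets since preimages commute with all Boolean operations.
\<close>

lemma borel_preimage:
  assumes h: "\<And>U. openin T' U \<Longrightarrow> borel_pred T TYPE('k) (\<lambda>x. h x \<in> U)"
    and total': "topspace T' = UNIV"
    and B: "B \<in> borel_sets_of (ord_rel :: 'k rel) T'"
  shows "borel_pred T TYPE('k) (\<lambda>x. h x \<in> B)"
  using B
proof induction
  case (union \<A>)
  show ?case
  proof (cases "\<A> = {}")
    case False
    then obtain g :: "'k \<Rightarrow> _" where "\<A> = range g"
      using surjection_if_small union(2) by blast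
    then show ?thesis using borel_ex[of "\<lambda>j x. h x \<in> g j"] union(1) by simp
  qed (use borel_const in auto)
next
  case (inter \<A>)
  then obtain g :: "'k \<Rightarrow> _" where "\<A> = range g"
    using surjection_if_small by blast
  then show ?case using borel_all[of "\<lambda>j x. h x \<in> g j"] inter(1) by simp
next
  case (compl A)
  then show ?case using borel_not total' by simp
qed (rule h)

lemma borel_agree_const:
  assumes "bitwise_borel T (u :: _ \<Rightarrow> 'k \<Rightarrow> bool)"
  shows "borel_pred T TYPE('k) (\<lambda>x. agree a p (u x))"
  unfolding agree_def
  by (intro borel_all borel_imp borel_const borel_iff) (use assms in \<open>simp add: bitwise_borel_def\<close>)

text \<open>
  Substitution into a Borel relation of functions all of whose bits are Borel. An open set is a union of
  \<open>\<kappa>\<close> basic sets, and membership in a basic set depends on fewer than \<open>\<kappa>\<close> bits.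
\<close>

lemma borel_pair_in:
  assumes u: "bitwise_borel T (u :: _ \<Rightarrow> 'k \<Rightarrow> bool)" and v: "bitwise_borel T (v :: _ \<Rightarrow> 'k \<Rightarrow> bool)"
    and R: "R \<in> borel_sets_of (ord_rel :: 'k rel) cantor_square"
  shows "borel_pred T TYPE('k) (\<lambda>x. (u x, v x) \<in> R)"
proof (rule borel_preimage[OF _ _ R])
  fix U :: "('k \<Rightarrow> bool) rel" assume U: "openin cantor_square U"
  have *: "(u x, v x) \<in> U \<longleftrightarrow> (\<exists>a i j. agree a (dense_points i) (u x) \<and> agree a (dense_points j) (v x) \<and>
      (\<forall>y z. agree a (dense_points i) y \<and> agree a (dense_points j) z \<longrightarrow> (y, z) \<in> U))" for x
  proof
    assume "(u x, v x) \<in> U"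
    then obtain a where a: "\<forall>y z. agree a (u x) y \<and> agree a (v x) z \<longrightarrow> (y, z) \<in> U"
      using U unfolding openin_cantor_square by blast
    obtain i j where ij: "agree a (dense_points i) (u x)" "agree a (dense_points j) (v x)"
      using dense_points by blast
    then have "\<forall>y z. agree a (dense_points i) y \<and> agree a (dense_points j) z \<longrightarrow> (y, z) \<in> U"
      using a by (meson agree_sym agree_trans)
    then show "\<exists>a i j. agree a (dense_points i) (u x) \<and> agree a (dense_points j) (v x) \<and>
      (\<forall>y z. agree a (dense_points i) y \<and> agree a (dense_points j) z \<longrightarrow> (y, z) \<in> U)"
      using ij by blast
  qed blast
  show "borel_pred T TYPE('k) (\<lambda>x. (u x, v x) \<in> U)"
    unfolding * by (intro borel_ex borel_conj borel_const borel_agree_const u v)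
qed simp

lemma borel_in:
  assumes u: "bitwise_borel T (u :: _ \<Rightarrow> 'k \<Rightarrow> bool)"
    and B: "B \<in> borel_sets_of (ord_rel :: 'k rel) cantor_topology"
  shows "borel_pred T TYPE('k) (\<lambda>x. u x \<in> B)"
proof (rule borel_preimage[OF _ _ B])
  fix U :: "('k \<Rightarrow> bool) set" assume U: "openin cantor_topology U"
  have *: "u x \<in> U \<longleftrightarrow> (\<exists>a i. agree a (dense_points i) (u x) \<and>
      (\<forall>y. agree a (dense_points i) y \<longrightarrow> y \<in> U))" for x
  proof
    assume "u x \<in> U"
    then obtain a where a: "\<forall>y. agree a (u x) y \<longrightarrow> y \<in> U"
      using U unfolding openin_cantor by blast
    obtain i where i: "agree a (dense_points i) (u x)"
      using dense_points by blast
    then have "\<forall>y. agree a (dense_points i) y \<longrightarrow> y \<in> U"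
      using a by (meson agree_sym agree_trans)
    then show "\<exists>a i. agree a (dense_points i) (u x) \<and>
      (\<forall>y. agree a (dense_points i) y \<longrightarrow> y \<in> U)"
      using i by blast
  qed blast
  show "borel_pred T TYPE('k) (\<lambda>x. u x \<in> U)"
    unfolding * by (intro borel_ex borel_conj borel_const borel_agree_const u)
qed simp

end

lemma bitwise_borel_fst: "bitwise_borel cantor_square (fst :: _ \<Rightarrow> 'k \<Rightarrow> bool)"
  unfolding bitwise_borel_def borel_pred_def
proof
  fix i :: 'k
  obtain a where "i < a" using no_greatest by blast
  then have "openin cantor_square {x :: ('k \<Rightarrow> bool) \<times> ('k \<Rightarrow> bool). fst x i}"
    unfolding openin_cantor_square by (auto simp: agree_def)
  then show "{x :: ('k \<Rightarrow> bool) \<times> ('k \<Rightarrow> bool). fst x i} \<in> borel_sets_of (ord_rel :: 'k rel) cantor_square"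
    by (rule borel_sets_of.open_set)
qed

lemma bitwise_borel_snd: "bitwise_borel cantor_square (snd :: _ \<Rightarrow> 'k \<Rightarrow> bool)"
  unfolding bitwise_borel_def borel_pred_def
proof
  fix i :: 'k
  obtain a where "i < a" using no_greatest by blast
  then have "openin cantor_square {x :: ('k \<Rightarrow> bool) \<times> ('k \<Rightarrow> bool). snd x i}"
    unfolding openin_cantor_square by (auto simp: agree_def)
  then show "{x :: ('k \<Rightarrow> bool) \<times> ('k \<Rightarrow> bool). snd x i} \<in> borel_sets_of (ord_rel :: 'k rel) cantor_square"
    by (rule borel_sets_of.open_set)
qed

lemma bitwise_borel_id: "bitwise_borel cantor_topology (\<lambda>x :: 'k \<Rightarrow> bool. x)"
  unfolding bitwise_borel_def borel_pred_def
proof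
  fix i :: 'k
  obtain a where "i < a" using no_greatest by blast
  then have "openin cantor_topology {x :: 'k \<Rightarrow> bool. x i}"
    unfolding openin_cantor by (auto simp: agree_def)
  then show "{x :: 'k \<Rightarrow> bool. x i} \<in> borel_sets_of (ord_rel :: 'k rel) cantor_topology"
    by (rule borel_sets_of.open_set)
qed

end

section \<open>An ideal of sets coding branches\<close>

definition slice :: "('k::wellorder \<Rightarrow> 'v) \<Rightarrow> 'k \<Rightarrow> 'k \<Rightarrow> 'v" where
  "slice u d i = u (pos (d, i))"

text \<open>
  Every \<open>i < \<kappa>\<close> stands for a node of the tree \<open>2\<^sup><\<^sup>\<kappa>\<close>: if \<open>i = pos (n, pos (a, j))\<close>, for the restriction of
  \<open>dense_points n\<close> to \<open>a\<close>. As \<open>j\<close> varies, each node occurs cofinally often.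
\<close>

definition node_length :: "'k::wellorder \<Rightarrow> 'k" where
  "node_length i = fst (inv pos (snd (inv pos i)))"

definition node_value :: "'k::wellorder \<Rightarrow> 'k \<Rightarrow> bool" where
  "node_value i = dense_points (fst (inv pos i))"

definition on_branch :: "'k::wellorder \<Rightarrow> ('k \<Rightarrow> bool) \<Rightarrow> bool" where
  "on_branch i b \<longleftrightarrow> agree (node_length i) (node_value i) b"

definition compatible :: "'k::wellorder \<Rightarrow> 'k \<Rightarrow> bool" where
  "compatible i j \<longleftrightarrow> agree (min (node_length i) (node_length j)) (node_value i) (node_value j)"

text \<open>
  Up to a bounded set there is no infinite antichain. The ideal must be Borel, and this
  condition prevents that a set of nodes has so many branches that they cannot be enumerated.
\<close>

definition thin :: "('k::wellorder \<Rightarrow> bool) \<Rightarrow> bool" where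
  "thin t \<longleftrightarrow> (\<exists>c. \<forall>\<sigma> :: nat \<Rightarrow> 'k. (\<forall>m. t (\<sigma> m) \<and> c \<le> \<sigma> m) \<longrightarrow>
    \<not> (\<forall>m m'. m < m' \<longrightarrow> \<not> compatible (\<sigma> m) (\<sigma> m')))"

definition along :: "('k::wellorder \<Rightarrow> bool) \<Rightarrow> ('k \<Rightarrow> bool) \<Rightarrow> bool" where
  "along t b \<longleftrightarrow> (\<forall>j. \<exists>i. t i \<and> j \<le> i \<and> j \<le> node_length i \<and> on_branch i b)"

text \<open>
  The ideal tests a set \<open>P\<close>: the nodes on a single branch \<open>b\<close>, or a cofinal selection of them, form a
  set in the ideal if and only if \<open>b \<in> P\<close> (\<open>branch_ideal_coding\<close>). So equality modulo the ideal is at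
  least as complicated as \<open>P\<close>, but all bounded sets are in the ideal.
\<close>

definition branch_ideal :: "('k::wellorder \<Rightarrow> bool) set \<Rightarrow> ('k \<Rightarrow> bool) set" where
  "branch_ideal P = {t. thin t \<and> (\<forall>b. along t b \<longrightarrow> b \<in> P)}"

definition ideal_rel :: "('k::wellorder \<Rightarrow> bool) set \<Rightarrow> ('k \<Rightarrow> bool) rel" where
  "ideal_rel P = {(u, v). (\<lambda>i. u i \<noteq> v i) \<in> branch_ideal P}"

lemma compatible_on_branch: "on_branch i b \<Longrightarrow> on_branch j b \<Longrightarrow> compatible i j"
  by (simp add: on_branch_def compatible_def agree_def)

lemma thin_mono:
  assumes "thin t" "\<And>i. s i \<Longrightarrow> t i"
  shows "thin s"
proof -
  obtain c where c: "\<And>\<sigma> :: nat \<Rightarrow> 'a. (\<forall>m. t (\<sigma> m) \<and> c \<le> \<sigma> m) \<Longrightarrow>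
      \<not> (\<forall>m m'. m < m' \<longrightarrow> \<not> compatible (\<sigma> m) (\<sigma> m'))"
    using assms(1) unfolding thin_def by blast
  show ?thesis unfolding thin_def
  proof (intro exI allI impI)
    fix \<sigma> :: "nat \<Rightarrow> 'a" assume "\<forall>m. s (\<sigma> m) \<and> c \<le> \<sigma> m"
    then have "\<forall>m. t (\<sigma> m) \<and> c \<le> \<sigma> m" using assms(2) by simp
    then show "\<not> (\<forall>m m'. m < m' \<longrightarrow> \<not> compatible (\<sigma> m) (\<sigma> m'))" by (rule c)
  qed
qed

text \<open>
  An infinite antichain in a union of two sets has infinitely many elements in one of them.
\<close>

lemma thin_union:
  assumes "thin s" "thin t"
  shows "thin (\<lambda>i. s i \<or> t i)"
proof -
  obtain c where c: "\<And>\<sigma> :: nat \<Rightarrow> 'a. (\<forall>m. s (\<sigma> m) \<and> c \<le> \<sigma> m) \<Longrightarrow>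
      \<not> (\<forall>m m'. m < m' \<longrightarrow> \<not> compatible (\<sigma> m) (\<sigma> m'))"
    using assms(1) unfolding thin_def by blast
  obtain d where d: "\<And>\<sigma> :: nat \<Rightarrow> 'a. (\<forall>m. t (\<sigma> m) \<and> d \<le> \<sigma> m) \<Longrightarrow>
      \<not> (\<forall>m m'. m < m' \<longrightarrow> \<not> compatible (\<sigma> m) (\<sigma> m'))"
    using assms(2) unfolding thin_def by blast
  have "\<not> (\<forall>m m'. m < m' \<longrightarrow> \<not> compatible (\<sigma> m) (\<sigma> m'))"
    if \<sigma>: "\<forall>m. (s (\<sigma> m) \<or> t (\<sigma> m)) \<and> max c d \<le> \<sigma> m" for \<sigma> :: "nat \<Rightarrow> 'a"
  proof
    assume anti: "\<forall>m m'. m < m' \<longrightarrow> \<not> compatible (\<sigma> m) (\<sigma> m')"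
    show False
    proof (cases "infinite {m. s (\<sigma> m)}")
      case True
      then obtain r :: "nat \<Rightarrow> nat" where "strict_mono r" "\<forall>n. s (\<sigma> (r n))"
        using infinite_enumerate by blast
      then show False using c[of "\<sigma> \<circ> r"] \<sigma> anti by (auto simp: strict_mono_def)
    next
      case False
      moreover have "UNIV = {m. s (\<sigma> m)} \<union> {m. t (\<sigma> m)}" using \<sigma> by auto
      ultimately have "infinite {m. t (\<sigma> m)}" by (metis finite_UnI infinite_UNIV_nat)
      then obtain r :: "nat \<Rightarrow> nat" where "strict_mono r" "\<forall>n. t (\<sigma> (r n))"
        using infinite_enumerate by blast
      then show False using d[of "\<sigma> \<circ> r"] \<sigma> anti by (auto simp: strict_mono_def)
    qed
  qed
  then show ?thesis unfolding thin_def by blast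
qed

lemma along_mono:
  assumes "along s b" "\<And>i. s i \<Longrightarrow> t i"
  shows "along t b"
  unfolding along_def
proof
  fix j
  obtain i where "s i" "j \<le> i" "j \<le> node_length i" "on_branch i b"
    using assms(1) unfolding along_def by blast
  then show "\<exists>i. t i \<and> j \<le> i \<and> j \<le> node_length i \<and> on_branch i b"
    using assms(2) by blast
qed

text \<open>
  Otherwise both sets leave the branch \<open>b\<close> at bounded positions.
\<close>

lemma along_union:
  assumes "along (\<lambda>i. s i \<or> t i) b"
  shows "along s b \<or> along t b"
proof (rule ccontr)
  assume "\<not> ?thesis"
  then obtain j k where
    j: "\<And>i. s i \<Longrightarrow> j \<le> i \<Longrightarrow> j \<le> node_length i \<Longrightarrow> \<not> on_branch i b" and
    k: "\<And>i. t i \<Longrightarrow> k \<le> i \<Longrightarrow> k \<le> node_length i \<Longrightarrow> \<not> on_branch i b"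
    unfolding along_def by blast
  obtain i where "s i \<or> t i" "max j k \<le> i" "max j k \<le> node_length i" "on_branch i b"
    using assms unfolding along_def by blast
  then show False using j[of i] k[of i] by auto
qed

lemma branch_ideal_mono:
  assumes "t \<in> branch_ideal P" "\<And>i. s i \<Longrightarrow> t i"
  shows "s \<in> branch_ideal P"
proof -
  have "thin s"
    by (rule thin_mono[of t]) (use assms in \<open>simp_all add: branch_ideal_def\<close>)
  moreover have "along t b" if "along s b" for b
    using that by (rule along_mono) (rule assms(2))
  ultimately show ?thesis using assms(1) unfolding branch_ideal_def by blast
qed

lemma branch_ideal_union:
  assumes "s \<in> branch_ideal P" "t \<in> branch_ideal P"
  shows "(\<lambda>i. s i \<or> t i) \<in> branch_ideal P"
proof -
  have s: "thin s" "\<forall>b. along s b \<longrightarrow> b \<in> P" and t: "thin t" "\<forall>b. along t b \<longrightarrow> b \<in> P"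
    using assms unfolding branch_ideal_def mem_Collect_eq by metis+
  have "\<forall>b. along (\<lambda>i. s i \<or> t i) b \<longrightarrow> b \<in> P"
    using s(2) t(2) along_union[of s t] by metis
  then show ?thesis using thin_union[OF s(1) t(1)] unfolding branch_ideal_def mem_Collect_eq by metis
qed

context kappa begin

lemma inj_cofinal: assumes "inj (f :: 'k \<Rightarrow> 'k)" shows "\<exists>j. c \<le> f j"
proof (rule ccontr)
  assume "\<not> ?thesis"
  then have "range f \<subseteq> {..<c}" by (auto simp: not_le)
  then have "|UNIV :: 'k set| \<le>o |{..<c}|" using assms card_of_ordLeq by blast
  then show False using initial_segment_small not_ordLess_ordLeq by blast
qed

lemma inj_preimage_bounded:
  assumes "inj (f :: 'k \<Rightarrow> 'k)" shows "\<exists>b. \<forall>i. f i < a \<longrightarrow> i < b"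
proof -
  obtain b where "\<forall>j<a. inv f j < b" using bounded_initial[of a "inv f"] by blast
  then show ?thesis using assms by (metis inv_f_f)
qed

text \<open>
  A branch can be continued outside any bounded set of positions that are already decided.
\<close>

lemma exists_node: "\<exists>i. node_length i = a \<and> on_branch i b \<and> (c :: 'k) \<le> i"
proof -
  obtain n where n: "agree a (dense_points n) b" using dense_points by blast
  have "inj (\<lambda>j::'k. pos (n, pos (a, j)))" by (auto intro!: injI)
  then obtain j where "c \<le> pos (n, pos (a, j))" using inj_cofinal by blast
  then show ?thesis using n
    by (intro exI[of _ "pos (n, pos (a, j))"]) (simp add: node_length_def node_value_def on_branch_def)
qed

lemma branch_ideal_bounded:
  assumes "\<And>i. t i \<Longrightarrow> i < (c :: 'k)" shows "t \<in> branch_ideal P"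
proof -
  have "thin t" unfolding thin_def
  proof (intro exI allI impI)
    fix \<sigma> :: "nat \<Rightarrow> 'k" assume "\<forall>m. t (\<sigma> m) \<and> c \<le> \<sigma> m"
    then have "t (\<sigma> 0)" "c \<le> \<sigma> 0" by auto
    then show "\<not> (\<forall>m m'. m < m' \<longrightarrow> \<not> compatible (\<sigma> m) (\<sigma> m'))"
      using assms[of "\<sigma> 0"] by simp
  qed
  moreover have "\<not> along t b" for b
  proof
    assume "along t b"
    then obtain i where "t i" "c \<le> i" unfolding along_def by blast
    then show False using assms[of i] by simp
  qed
  ultimately show ?thesis unfolding branch_ideal_def by blast
qed

lemma branch_ideal_coding:
  assumes on: "\<And>i. t i \<Longrightarrow> on_branch i b" and along: "along t (b :: 'k \<Rightarrow> bool)"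
  shows "t \<in> branch_ideal P \<longleftrightarrow> b \<in> P"
proof -
  have "thin t" unfolding thin_def
  proof (intro exI allI impI)
    fix \<sigma> :: "nat \<Rightarrow> 'k" assume "\<forall>m. t (\<sigma> m) \<and> ord0 \<le> \<sigma> m"
    then have "compatible (\<sigma> 0) (\<sigma> 1)" using on compatible_on_branch by blast
    then show "\<not> (\<forall>m m'. m < m' \<longrightarrow> \<not> compatible (\<sigma> m) (\<sigma> m'))"
      by (intro notI) (drule spec[of _ 0], drule spec[of _ 1], simp)
  qed
  moreover have "b' = b" if b': "along t b'" for b'
  proof
    fix j :: 'k
    obtain j' where "j < j'" using no_greatest by blast
    obtain i where "t i" "j' \<le> node_length i" "on_branch i b'"
      using b' unfolding along_def by blast
    moreover from this have "j < node_length i" using \<open>j < j'\<close> by simp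
    ultimately show "b' j = b j" using on[of i] by (simp add: on_branch_def agree_def)
  qed
  ultimately show ?thesis using along unfolding branch_ideal_def by blast
qed

lemma equiv_ideal_rel: "equiv UNIV (ideal_rel (P :: ('k \<Rightarrow> bool) set))"
proof (intro equivI refl_onI symI transI)
  fix x :: "'k \<Rightarrow> bool"
  show "(x, x) \<in> ideal_rel P"
    unfolding ideal_rel_def using branch_ideal_bounded[of "\<lambda>i. x i \<noteq> x i"] by simp
next
  fix x y assume "(x, y) \<in> ideal_rel P"
  moreover have "(\<lambda>i. y i \<noteq> x i) = (\<lambda>i. x i \<noteq> y i)" by auto
  ultimately show "(y, x) \<in> ideal_rel P" unfolding ideal_rel_def by simp
next
  fix x y z assume "(x, y) \<in> ideal_rel P" "(y, z) \<in> ideal_rel P"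
  then have "(\<lambda>i. x i \<noteq> y i \<or> y i \<noteq> z i) \<in> branch_ideal P"
    unfolding ideal_rel_def by (simp add: branch_ideal_union)
  then have "(\<lambda>i. x i \<noteq> z i) \<in> branch_ideal P"
    by (rule branch_ideal_mono) auto
  then show "(x, z) \<in> ideal_rel P" unfolding ideal_rel_def by simp
qed auto

text \<open>
  If every initial segment of \<open>b\<close> had an extension in \<open>t\<close> that is not on \<open>b\<close> then such nodes, splitting
  from \<open>b\<close> at increasing levels, would form an infinite antichain.
\<close>

lemma thin_isolates_branch:
  assumes thin: "thin t"
  shows "\<exists>a c :: 'k. \<forall>i. t i \<and> c \<le> i \<and> a \<le> node_length i \<and> agree a (node_value i) b \<longrightarrow> on_branch i b"
proof (rule ccontr)
  assume not: "\<not> ?thesis"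
  obtain c where c: "\<And>\<sigma> :: nat \<Rightarrow> 'k. (\<forall>m. t (\<sigma> m) \<and> c \<le> \<sigma> m) \<Longrightarrow>
      \<not> (\<forall>m m'. m < m' \<longrightarrow> \<not> compatible (\<sigma> m) (\<sigma> m'))"
    using thin unfolding thin_def by blast
  \<comment> \<open>The node i follows b up to a and has left b before a'.\<close>
  define good where "good = (\<lambda>(i, a, a'). t i \<and> c \<le> i \<and> a \<le> node_length i \<and> agree a (node_value i) b
    \<and> a \<le> a' \<and> (\<exists>j<a'. j < node_length i \<and> node_value i j \<noteq> b j))"
  have ex: "\<exists>i a'. good (i, a, a')" for a
  proof -
    obtain i where i: "t i" "c \<le> i" "a \<le> node_length i" "agree a (node_value i) b" "\<not> on_branch i b"
      using not by blast
    then obtain j where j: "j < node_length i" "node_value i j \<noteq> b j"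
      unfolding on_branch_def agree_def by blast
    obtain j' where "j < j'" using no_greatest by blast
    then have "good (i, a, max a j')" unfolding good_def using i j
      by (auto intro!: exI[of _ j] simp: less_max_iff_disj)
    then show ?thesis by blast
  qed
  obtain s where s: "\<And>n. good (s n)" "\<And>n. fst (snd (s (Suc n))) = snd (snd (s n))"
  proof -
    have "\<exists>s. \<forall>n. good (s n) \<and> fst (snd (s (Suc n))) = snd (snd (s n))"
      by (rule dependent_nat_choice) (use ex in \<open>force+\<close>)
    then show ?thesis using that by blast
  qed
  define i where "i = (\<lambda>n. fst (s n))"
  define a where "a = (\<lambda>n. fst (snd (s n)))"
  have g: "good (i n, a n, a (Suc n))" for n
    using s[of n] unfolding i_def a_def by simp
  have mono: "a m \<le> a n" if "m \<le> n" for m n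
    using that by (rule lift_Suc_mono_le[rotated]) (use g in \<open>simp add: good_def\<close>)
  have "\<not> compatible (i m) (i n)" if "m < n" for m n
  proof -
    obtain j where j: "j < a (Suc m)" "j < node_length (i m)" "node_value (i m) j \<noteq> b j"
      using g[of m] unfolding good_def by auto
    have "j < a n" using j(1) mono[of "Suc m" n] that by (simp add: order_less_le_trans)
    then have "j < node_length (i n)" "node_value (i n) j = b j"
      using g[of n] unfolding good_def agree_def by (auto intro: order_less_le_trans)
    then show ?thesis using j unfolding compatible_def agree_def by auto
  qed
  moreover have "\<forall>m. t (i m) \<and> c \<le> i m" using g unfolding good_def by simp
  ultimately show False using c[of i] by blast
qed

text \<open>
  The nodes in \<open>t\<close> beyond position \<open>c\<close> that extend the node \<open>s\<close> are considered. If they are linearly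
  ordered then their union is a branch that depends on \<open>t\<close> in a Borel way. In a thin set all branches
  arise in this way, for \<open>\<kappa>\<close> many pairs \<open>(s, c)\<close>, so the quantifier over branches can be
  eliminated from the definition of the ideal.
\<close>

definition node_below :: "'k \<Rightarrow> 'k \<Rightarrow> bool" where
  "node_below s i \<longleftrightarrow> node_length s \<le> node_length i \<and> agree (node_length s) (node_value s) (node_value i)"

definition linear_above :: "('k \<Rightarrow> bool) \<Rightarrow> 'k \<Rightarrow> 'k \<Rightarrow> bool" where
  "linear_above t s c \<longleftrightarrow> (\<forall>i j. t i \<and> t j \<and> c \<le> i \<and> c \<le> j \<and> node_below s i \<and> node_below s j \<longrightarrow> compatible i j)"

definition cofinal_above :: "('k \<Rightarrow> bool) \<Rightarrow> 'k \<Rightarrow> bool" where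
  "cofinal_above t s \<longleftrightarrow> (\<forall>j. \<exists>i. t i \<and> j \<le> i \<and> j \<le> node_length i \<and> node_below s i)"

definition union_above :: "('k \<Rightarrow> bool) \<Rightarrow> 'k \<Rightarrow> 'k \<Rightarrow> 'k \<Rightarrow> bool" where
  "union_above t s c j \<longleftrightarrow> (\<exists>i. t i \<and> c \<le> i \<and> node_below s i \<and> j < node_length i \<and> node_value i j)"

lemma along_union_above:
  assumes "linear_above t s c" "cofinal_above t s"
  shows "along t (union_above t s c)"
proof -
  have on: "on_branch i (union_above t s c)" if i: "t i" "c \<le> i" "node_below s i" for i
    unfolding on_branch_def agree_def
  proof (intro allI impI)
    fix j assume j: "j < node_length i"
    show "node_value i j = union_above t s c j"
    proof
      assume "node_value i j"
      then show "union_above t s c j" unfolding union_above_def using i j by blast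
    next
      assume "union_above t s c j"
      then obtain i' where i': "t i'" "c \<le> i'" "node_below s i'" "j < node_length i'" "node_value i' j"
        unfolding union_above_def by blast
      then have "compatible i i'" using assms(1) i unfolding linear_above_def by blast
      then show "node_value i j" using i'(4,5) j unfolding compatible_def agree_def by simp
    qed
  qed
  show ?thesis unfolding along_def
  proof
    fix j
    obtain i where "t i" "max j c \<le> i" "max j c \<le> node_length i" "node_below s i"
      using assms(2) unfolding cofinal_above_def by blast
    then show "\<exists>i. t i \<and> j \<le> i \<and> j \<le> node_length i \<and> on_branch i (union_above t s c)"
      using on[of i] by auto
  qed
qed

lemma along_eq_union_above:
  assumes "thin t" "along t b"
  shows "\<exists>s c. linear_above t s c \<and> cofinal_above t s \<and> union_above t s c = b"
proof -
  obtain a c where iso: "\<And>i. t i \<Longrightarrow> c \<le> i \<Longrightarrow> a \<le> node_length i \<Longrightarrow> agree a (node_value i) b \<Longrightarrow> on_branch i b"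
    using thin_isolates_branch[OF assms(1)] by blast
  obtain s where s: "node_length s = a" "on_branch s b" using exists_node by blast
  have below: "node_below s i" if "on_branch i b" "a \<le> node_length i" for i
    using that s unfolding node_below_def on_branch_def agree_def by auto
  have on: "on_branch i b" if "t i" "c \<le> i" "node_below s i" for i
  proof (rule iso)
    show "agree a (node_value i) b"
      using that(3) s unfolding node_below_def on_branch_def agree_def by auto
  qed (use that s in \<open>auto simp: node_below_def\<close>)
  have many: "\<exists>i. t i \<and> j \<le> i \<and> c \<le> i \<and> j \<le> node_length i \<and> node_below s i \<and> on_branch i b" for j
  proof -
    obtain i where "t i" "max j (max a c) \<le> i" "max j (max a c) \<le> node_length i" "on_branch i b"
      using assms(2) unfolding along_def by blast
    then show ?thesis using below[of i] by auto
  qed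
  have "linear_above t s c" unfolding linear_above_def using on compatible_on_branch by blast
  moreover have "cofinal_above t s" unfolding cofinal_above_def using many by blast
  moreover have "union_above t s c j = b j" for j
  proof
    assume "union_above t s c j"
    then show "b j" unfolding union_above_def using on unfolding on_branch_def agree_def by blast
  next
    assume "b j"
    obtain j' where "j < j'" using no_greatest by blast
    moreover obtain i where "t i" "c \<le> i" "j' \<le> node_length i" "node_below s i" "on_branch i b"
      using many by blast
    ultimately show "union_above t s c j"
      unfolding union_above_def using \<open>b j\<close> unfolding on_branch_def agree_def
      by (intro exI[of _ i]) auto
  qed
  ultimately show ?thesis by blast
qed

lemma branch_ideal_iff:
  "t \<in> branch_ideal P \<longleftrightarrow>
    thin t \<and> (\<forall>s c. linear_above t s c \<and> cofinal_above t s \<longrightarrow> union_above t s c \<in> P)"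
  unfolding branch_ideal_def using along_union_above along_eq_union_above by blast

lemma borel_branch_ideal:
  fixes u :: "'a \<Rightarrow> 'k \<Rightarrow> bool"
  assumes T: "topspace T = UNIV" and u: "bitwise_borel T u"
    and P: "P \<in> borel_sets_of (ord_rel :: 'k rel) cantor_topology"
  shows "borel_pred T TYPE('k) (\<lambda>x. u x \<in> branch_ideal P)"
proof -
  note intros = borel_all[OF T] borel_ex[OF T] borel_conj[OF T] borel_imp[OF T] borel_not[OF T]
    borel_const[OF T] borel_all_sequences[OF T]
  have bit: "borel_pred T TYPE('k) (\<lambda>x. u x i)" for i
    using u unfolding bitwise_borel_def by blast
  have nat: "borel_pred T TYPE('k) (\<lambda>x. \<forall>m. u x (\<sigma> m) \<and> c \<le> \<sigma> m)" for \<sigma> :: "nat \<Rightarrow> 'k" and c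
  proof -
    have "(\<forall>m. u x (\<sigma> m) \<and> c \<le> \<sigma> m) \<longleftrightarrow> (\<forall>i. i \<in> range \<sigma> \<longrightarrow> u x i \<and> c \<le> i)" for x
      by blast
    then show ?thesis by (simp only:) (intro intros bit)
  qed
  have "bitwise_borel T (\<lambda>x. union_above (u x) s c)" for s c
    unfolding bitwise_borel_def union_above_def by (intro allI intros bit)
  then have above: "borel_pred T TYPE('k) (\<lambda>x. union_above (u x) s c \<in> P)" for s c
    using borel_in[OF T _ P] by blast
  show ?thesis
    unfolding branch_ideal_iff thin_def linear_above_def cofinal_above_def
    by (intro intros bit nat above)
qed

end

section \<open>The relations \<open>E\<^sub>Y\<close>\<close>

definition cofinality_omega :: "'k::wellorder \<Rightarrow> bool" where
  "cofinality_omega \<beta> \<longleftrightarrow> (\<exists>\<alpha> :: nat \<Rightarrow> 'k. strict_mono \<alpha> \<and> (LEAST s. \<forall>i. \<alpha> i \<le> s) = \<beta>)"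

definition tail_rel :: "('k::wellorder \<Rightarrow> bool) \<Rightarrow> ('k \<Rightarrow> bool) rel" where
  "tail_rel Z = {(u, v). \<forall>\<beta>. cofinality_omega \<beta> \<and> Z \<beta> \<longrightarrow>
    (\<exists>\<alpha><\<beta>. \<forall>d. \<alpha> \<le> d \<and> d < \<beta> \<longrightarrow> slice u d = slice v d)}"

text \<open>
  The slices of \<open>b\<close> are two points and a set \<open>X\<close>. That \<open>X\<close> is coded in \<open>b\<close> makes one relation \<open>Q\<^sub>d\<close>
  work against reductions to all the relations \<open>E\<^sub>X\<close>.
\<close>

definition failure :: "('k::wellorder \<Rightarrow> ('k \<Rightarrow> bool) rel) \<Rightarrow> 'k \<Rightarrow> ('k \<Rightarrow> bool) set" where
  "failure q d = {b. \<not> ((\<forall>e<d. (slice (slice b ord0) e, slice (slice b ord1) e) \<in> q e) \<and>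
    (slice b ord0, slice b ord1) \<in> tail_rel (slice b ord2))}"

text \<open>
  The relation with index \<open>0\<close> stores the condition on the points of \<open>Y\<close>, with \<open>Y\<close> as an invariant. For
  other \<open>d\<close> there are two factors: the product of the previous relations, which makes the relations
  increasing, and the relation that diagonalizes against reductions to the previous ones.
\<close>

definition tower_step :: "'k::wellorder \<Rightarrow> ('k \<Rightarrow> ('k \<Rightarrow> bool) rel) \<Rightarrow> ('k \<Rightarrow> bool) rel" where
  "tower_step d q = {(u, v).
    if d = ord0 then slice u ord0 = slice v ord0 \<and>
      (slice u ord1, slice v ord1) \<in> tail_rel (slice u ord0)
    else (\<forall>e<d. (slice u e, slice v e) \<in> q e) \<and>
      (slice u d, slice v d) \<in> ideal_rel (failure q d)}"

function tower :: "'k::wellorder \<Rightarrow> ('k \<Rightarrow> bool) rel" where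
  "tower d = tower_step d (\<lambda>e. if e < d then tower e else {})"
  by auto
termination by (relation "{(x, y). x < y}") (auto simp: wf)

declare tower.simps [simp del]

lemma failure_cong: "(\<And>e. e < d \<Longrightarrow> q e = r e) \<Longrightarrow> failure q d = failure r d"
  by (simp add: failure_def)

lemma tower_base:
  "(u, v) \<in> tower ord0 \<longleftrightarrow> slice u ord0 = slice v ord0 \<and>
    (slice u ord1, slice v ord1) \<in> tail_rel (slice u ord0)"
  by (subst tower.simps) (simp add: tower_step_def)

lemma tower_above:
  assumes "d \<noteq> ord0"
  shows "(u, v) \<in> tower d \<longleftrightarrow> (\<forall>e<d. (slice u e, slice v e) \<in> tower e) \<and>
    (slice u d, slice v d) \<in> ideal_rel (failure tower d)"
proof -
  have "failure (\<lambda>e. if e < d then tower e else {}) d = failure tower d"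
    by (rule failure_cong) simp
  then show ?thesis using assms by (subst tower.simps) (simp add: tower_step_def)
qed

definition embedded_rel :: "'k::wellorder set \<Rightarrow> ('k \<Rightarrow> bool) rel" where
  "embedded_rel Y = {(x, y). (\<forall>d. (slice x d, slice y d) \<in> tower d) \<and> (x, y) \<in> tail_rel (\<lambda>\<beta>. \<beta> \<in> Y)}"

context kappa begin

lemma cofinal_sequence:
  assumes "strict_mono (\<alpha> :: nat \<Rightarrow> 'k)" "(LEAST s. \<forall>i. \<alpha> i \<le> s) = \<beta>"
  shows "\<alpha> i < \<beta>" "\<gamma> < \<beta> \<Longrightarrow> \<exists>i. \<gamma> < \<alpha> i"
proof -
  obtain b where "\<forall>n. \<alpha> n < b" using bounded_sequence by blast
  then have "\<exists>s. \<forall>i. \<alpha> i \<le> s" by (meson order_less_imp_le)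
  then have ub: "\<forall>i. \<alpha> i \<le> \<beta>"
    using LeastI_ex[of "\<lambda>s. \<forall>i. \<alpha> i \<le> s"] assms(2) by simp
  have "\<alpha> i < \<alpha> (Suc i)" using assms(1) by (simp add: strict_mono_def)
  then show "\<alpha> i < \<beta>" using ub by (metis order_less_le_trans)
  assume "\<gamma> < \<beta>"
  then have "\<not> (\<forall>i. \<alpha> i \<le> \<gamma>)" using assms(2) not_less_Least by blast
  then show "\<exists>i. \<gamma> < \<alpha> i" by (auto simp: not_le)
qed

lemma least_bound_sequence:
  assumes "strict_mono (\<alpha> :: nat \<Rightarrow> 'k)" "\<And>i. \<alpha> i < \<beta>" "\<And>\<gamma>. \<gamma> < \<beta> \<Longrightarrow> \<exists>i. \<gamma> < \<alpha> i"
  shows "(LEAST s. \<forall>i. \<alpha> i \<le> s) = \<beta>"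
proof (rule Least_equality)
  show "\<forall>i. \<alpha> i \<le> \<beta>" using assms(2) by (simp add: order_less_imp_le)
  fix \<gamma> assume "\<forall>i. \<alpha> i \<le> \<gamma>"
  then show "\<beta> \<le> \<gamma>" using assms(3)[of \<gamma>] by (meson not_le)
qed

lemma cofinality_omega_limit:
  assumes "cofinality_omega \<beta>" "\<gamma> < (\<beta> :: 'k)"
  shows "\<exists>\<delta>. \<gamma> < \<delta> \<and> \<delta> < \<beta>"
proof -
  obtain \<alpha> :: "nat \<Rightarrow> 'k" where \<alpha>: "strict_mono \<alpha>" "(LEAST s. \<forall>i. \<alpha> i \<le> s) = \<beta>"
    using assms(1) unfolding cofinality_omega_def by blast
  then obtain i where "\<gamma> < \<alpha> i" using cofinal_sequence(2)[OF \<alpha> assms(2)] by blast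
  then show ?thesis using cofinal_sequence(1)[OF \<alpha>] by blast
qed

lemma cofinality_omega_pos:
  assumes "cofinality_omega \<beta>"
  shows "ord0 < (\<beta> :: 'k)"
proof -
  obtain \<alpha> :: "nat \<Rightarrow> 'k" where \<alpha>: "strict_mono \<alpha>" "(LEAST s. \<forall>i. \<alpha> i \<le> s) = \<beta>"
    using assms unfolding cofinality_omega_def by blast
  have "\<alpha> 0 < \<beta>" by (rule cofinal_sequence(1)[OF \<alpha>])
  then show ?thesis by (rule le_less_trans[OF ord0_le])
qed

lemma equiv_tail_rel: "equiv UNIV (tail_rel (Z :: 'k \<Rightarrow> bool))"
proof (intro equivI refl_onI symI transI)
  fix x :: "'k \<Rightarrow> bool" show "(x, x) \<in> tail_rel Z"
    unfolding tail_rel_def using cofinality_omega_pos by blast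
next
  fix x y assume "(x, y) \<in> tail_rel Z"
  then show "(y, x) \<in> tail_rel Z" unfolding tail_rel_def by (simp add: eq_commute)
next
  fix x y z assume xy: "(x, y) \<in> tail_rel Z" and yz: "(y, z) \<in> tail_rel Z"
  have "\<exists>\<alpha><\<beta>. \<forall>d. \<alpha> \<le> d \<and> d < \<beta> \<longrightarrow> slice x d = slice z d" if \<beta>: "cofinality_omega \<beta>" "Z \<beta>" for \<beta>
  proof -
    obtain a where a: "a < \<beta>" "\<forall>d. a \<le> d \<and> d < \<beta> \<longrightarrow> slice x d = slice y d"
      using \<beta> xy unfolding tail_rel_def by blast
    obtain b where b: "b < \<beta>" "\<forall>d. b \<le> d \<and> d < \<beta> \<longrightarrow> slice y d = slice z d"
      using \<beta> yz unfolding tail_rel_def by blast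
    show ?thesis using a b by (intro exI[of _ "max a b"]) auto
  qed
  then show "(x, z) \<in> tail_rel Z" unfolding tail_rel_def by blast
qed auto

lemma equiv_pullback_all:
  assumes "\<And>i. i \<in> I \<Longrightarrow> equiv UNIV (R i)"
  shows "equiv UNIV {(x, y). \<forall>i\<in>I. (f i x, f i y) \<in> R i}"
proof (intro equivI refl_onI symI transI)
  fix x show "(x, x) \<in> {(x, y). \<forall>i\<in>I. (f i x, f i y) \<in> R i}"
    using assms by (auto dest: equiv_class_self simp: equiv_def refl_on_def)
next
  fix x y assume "(x, y) \<in> {(x, y). \<forall>i\<in>I. (f i x, f i y) \<in> R i}"
  then show "(y, x) \<in> {(x, y). \<forall>i\<in>I. (f i x, f i y) \<in> R i}"
    using assms by (auto simp: equiv_def dest: symD)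
next
  fix x y z
  assume "(x, y) \<in> {(x, y). \<forall>i\<in>I. (f i x, f i y) \<in> R i}" "(y, z) \<in> {(x, y). \<forall>i\<in>I. (f i x, f i y) \<in> R i}"
  then show "(x, z) \<in> {(x, y). \<forall>i\<in>I. (f i x, f i y) \<in> R i}"
    using assms unfolding equiv_def by (auto intro: transD)
qed auto

lemma equiv_Int:
  assumes "equiv UNIV R" "equiv UNIV S"
  shows "equiv UNIV (R \<inter> S)"
proof (rule equivI)
  show "refl_on UNIV (R \<inter> S)"
    using assms by (metis Int_UNIV equiv_def refl_on_Int)
  show "sym (R \<inter> S)" using assms by (metis equiv_def sym_Int)
  show "trans (R \<inter> S)" using assms by (metis equiv_def trans_Int)
qed auto

lemma equiv_tower: "equiv UNIV (tower (d :: 'k))"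
proof (induction d rule: less_induct)
  case (less d)
  show ?case
  proof (cases "d = ord0")
    case True
    have tail: "refl_on UNIV (tail_rel (Z :: 'k \<Rightarrow> bool))" "sym (tail_rel Z)" "trans (tail_rel Z)" for Z
      using equiv_tail_rel[of Z] by (auto elim: equivE)
    show ?thesis unfolding True
    proof (rule equivI)
      show "refl_on UNIV (tower (ord0 :: 'k))"
        by (intro refl_onI) (simp_all add: tower_base refl_onD[OF tail(1)])
      show "sym (tower (ord0 :: 'k))"
      proof (rule symI)
        fix x y :: "'k \<Rightarrow> bool" assume "(x, y) \<in> tower ord0"
        then show "(y, x) \<in> tower ord0" unfolding tower_base by (metis symD[OF tail(2)])
      qed
      show "trans (tower (ord0 :: 'k))"
      proof (rule transI)
        fix x y z :: "'k \<Rightarrow> bool" assume "(x, y) \<in> tower ord0" "(y, z) \<in> tower ord0"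
        then show "(x, z) \<in> tower ord0" unfolding tower_base by (metis transD[OF tail(3)])
      qed
    qed auto
  next
    case False
    have eq: "tower d = {(u, v). \<forall>e\<in>{..<d}. (slice u e, slice v e) \<in> tower e} \<inter>
        {(u, v). \<forall>e\<in>{d}. (slice u e, slice v e) \<in> ideal_rel (failure tower d)}"
    proof (intro set_eqI)
      show "p \<in> tower d \<longleftrightarrow> p \<in> {(u, v). \<forall>e\<in>{..<d}. (slice u e, slice v e) \<in> tower e} \<inter>
        {(u, v). \<forall>e\<in>{d}. (slice u e, slice v e) \<in> ideal_rel (failure tower d)}" for p
        by (cases p) (auto simp: tower_above[OF False])
    qed
    show ?thesis unfolding eq
    proof (rule equiv_Int)
      show "equiv UNIV {(u, v). \<forall>e\<in>{..<d}. (slice u e, slice v e) \<in> tower e}"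
        by (rule equiv_pullback_all) (use less in simp)
      show "equiv UNIV {(u, v). \<forall>e\<in>{d}. (slice u e, slice v e) \<in> ideal_rel (failure tower d)}"
        by (rule equiv_pullback_all) (rule equiv_ideal_rel)
    qed
  qed
qed

lemma equiv_embedded_rel: "equiv UNIV (embedded_rel (Y :: 'k set))"
proof -
  have "embedded_rel Y = {(x, y). \<forall>d\<in>UNIV. (slice x d, slice y d) \<in> tower d} \<inter> tail_rel (\<lambda>\<beta>. \<beta> \<in> Y)"
    unfolding embedded_rel_def by auto
  moreover have "equiv UNIV {(x, y). \<forall>d\<in>UNIV. (slice x d, slice y d) \<in> tower (d :: 'k)}"
    by (rule equiv_pullback_all) (rule equiv_tower)
  moreover note equiv_tail_rel[of "\<lambda>\<beta>. \<beta> \<in> Y"]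
  ultimately show ?thesis by (simp only: equiv_Int)
qed

lemma tower_refl: "(u, u) \<in> tower (d :: 'k)"
  using equiv_tower by (auto simp: equiv_def refl_on_def)

lemma bitwise_borel_slice:
  "bitwise_borel T (u :: 'a \<Rightarrow> 'k \<Rightarrow> bool) \<Longrightarrow> bitwise_borel T (\<lambda>x. slice (u x) d)"
  unfolding bitwise_borel_def slice_def by simp

context
  fixes T :: "'a topology"
  assumes T: "topspace T = UNIV"
begin

lemma borel_eq:
  assumes "bitwise_borel T (u :: 'a \<Rightarrow> 'k \<Rightarrow> bool)" "bitwise_borel T v"
  shows "borel_pred T TYPE('k) (\<lambda>x. u x = v x)"
  unfolding fun_eq_iff
  by (intro borel_all[OF T] borel_iff[OF T]) (use assms in \<open>simp_all add: bitwise_borel_def\<close>)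

lemma borel_tail_rel:
  assumes u: "bitwise_borel T (u :: 'a \<Rightarrow> 'k \<Rightarrow> bool)" and v: "bitwise_borel T v"
    and z: "bitwise_borel T z"
  shows "borel_pred T TYPE('k) (\<lambda>x. (u x, v x) \<in> tail_rel (z x))"
proof -
  have "borel_pred T TYPE('k) (\<lambda>x. z x \<beta>)" for \<beta>
    using z unfolding bitwise_borel_def by blast
  then show ?thesis unfolding tail_rel_def mem_Collect_eq case_prod_conv
    by (intro borel_all[OF T] borel_imp[OF T] borel_conj[OF T] borel_const[OF T] borel_ex[OF T]
        borel_eq bitwise_borel_slice u v)
qed

end

lemma borel_failure:
  assumes q: "\<And>e. e < d \<Longrightarrow> q e \<in> borel_sets_of (ord_rel :: 'k rel) cantor_square"
  shows "failure q (d :: 'k) \<in> borel_sets_of (ord_rel :: 'k rel) cantor_topology"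
proof -
  let ?T = "cantor_topology :: ('k \<Rightarrow> bool) topology"
  have T: "topspace ?T = UNIV" by simp
  have col: "bitwise_borel ?T (\<lambda>b. slice b e)" for e
    by (intro bitwise_borel_slice bitwise_borel_id)
  have "borel_pred ?T TYPE('k)
      (\<lambda>b. e < d \<longrightarrow> (slice (slice b ord0) e, slice (slice b ord1) e) \<in> q e)" for e
  proof (cases "e < d")
    case True
    then show ?thesis
      using borel_pair_in[OF T _ _ q[OF True], of "\<lambda>b. slice (slice b ord0) e" "\<lambda>b. slice (slice b ord1) e"]
      by (simp add: bitwise_borel_slice col)
  qed (use borel_const[OF T, of True] in simp)
  then have "borel_pred ?T TYPE('k) (\<lambda>b. b \<in> failure q d)"
    unfolding failure_def mem_Collect_eq
    by (intro borel_not[OF T] borel_conj[OF T] borel_all[OF T] borel_tail_rel[OF T] col)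
  then show ?thesis unfolding borel_pred_def by simp
qed

text \<open>
  By induction on \<open>d\<close>: the test set \<open>failure tower d\<close> is Borel because only relations of smaller index
  occur in it, and the ideal of a Borel set is Borel.
\<close>

lemma borel_tower: "tower (d :: 'k) \<in> borel_sets_of (ord_rel :: 'k rel) cantor_square"
proof (induction d rule: less_induct)
  case (less d)
  let ?T = "cantor_square :: (('k \<Rightarrow> bool) \<times> ('k \<Rightarrow> bool)) topology"
  have T: "topspace ?T = UNIV" by simp
  have col: "bitwise_borel ?T (\<lambda>x. slice (fst x) e)" "bitwise_borel ?T (\<lambda>x. slice (snd x) e)" for e
    by (intro bitwise_borel_slice bitwise_borel_fst bitwise_borel_snd)+
  have "borel_pred ?T TYPE('k) (\<lambda>x. (fst x, snd x) \<in> tower d)"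
  proof (cases "d = ord0")
    case True
    show ?thesis unfolding True tower_base
      by (intro borel_conj[OF T] borel_eq[OF T] borel_tail_rel[OF T] col)
  next
    case False
    have "borel_pred ?T TYPE('k) (\<lambda>x. e < d \<longrightarrow> (slice (fst x) e, slice (snd x) e) \<in> tower e)" for e
    proof (cases "e < d")
      case True
      then show ?thesis using borel_pair_in[OF T col less[OF True]] by simp
    qed (use borel_const[OF T, of True] in simp)
    moreover have "bitwise_borel ?T (\<lambda>x i. slice (fst x) d i \<noteq> slice (snd x) d i)"
      unfolding bitwise_borel_def
      by (intro allI borel_not[OF T] borel_iff[OF T]) (use col[of d] in \<open>simp_all add: bitwise_borel_def\<close>)
    then have "borel_pred ?T TYPE('k)
        (\<lambda>x. (\<lambda>i. slice (fst x) d i \<noteq> slice (snd x) d i) \<in> branch_ideal (failure tower d))"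
      by (rule borel_branch_ideal[OF T]) (rule borel_failure, rule less)
    ultimately show ?thesis unfolding tower_above[OF False] ideal_rel_def mem_Collect_eq case_prod_conv
      by (intro borel_conj[OF T] borel_all[OF T])
  qed
  then show ?case unfolding borel_pred_def by simp
qed

lemma embedded_rel_borel_equiv: "embedded_rel (Y :: 'k set) \<in> borel_equivs"
proof -
  let ?T = "cantor_square :: (('k \<Rightarrow> bool) \<times> ('k \<Rightarrow> bool)) topology"
  have T: "topspace ?T = UNIV" by simp
  have col: "bitwise_borel ?T (\<lambda>x. slice (fst x) e)" "bitwise_borel ?T (\<lambda>x. slice (snd x) e)" for e
    by (intro bitwise_borel_slice bitwise_borel_fst bitwise_borel_snd)+
  have const: "bitwise_borel ?T (\<lambda>x i. i \<in> Y)"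
    unfolding bitwise_borel_def using borel_const[OF T] by blast
  have "borel_pred ?T TYPE('k) (\<lambda>x. (fst x, snd x) \<in> embedded_rel Y)"
    unfolding embedded_rel_def mem_Collect_eq case_prod_conv
    by (intro borel_conj[OF T] borel_all[OF T] borel_pair_in[OF T] borel_tail_rel[OF T]
        col borel_tower bitwise_borel_fst bitwise_borel_snd const)
  then show ?thesis
    unfolding borel_equivs_def borel_pred_def using equiv_embedded_rel by simp
qed

section \<open>Reductions along an \<open>\<omega>\<close>-cub set\<close>

lemma reducible_if_nonstationary:
  assumes C: "omega_closed C" "unbounded C" and disjoint: "(X - Y) \<inter> C = {}"
  shows "borel_reducible (embedded_rel Y) (embedded_rel (X :: 'k set))"
proof -
  define nxt where "nxt = (\<lambda>e. LEAST c. c \<in> C \<and> e < c)"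
  have nxt: "nxt e \<in> C" "e < nxt e" for e
  proof -
    have "\<exists>c. c \<in> C \<and> e < c" using C(2) unfolding unbounded_def by blast
    from LeastI_ex[OF this] show "nxt e \<in> C" "e < nxt e" unfolding nxt_def by auto
  qed
  have nxt_le: "nxt e \<le> c" if "c \<in> C" "e < c" for e c
    unfolding nxt_def using that by (simp add: Least_le)
  \<comment> \<open>For d in C the slice d of the image contains the slices x_e such that d is the next element of C
    above e. As always e < d, the part on which Q_d is equality modulo the ideal stays constant.\<close>
  define f :: "('k \<Rightarrow> bool) \<Rightarrow> 'k \<Rightarrow> bool" where
    "f = (\<lambda>x i. case inv pos i of (d, j) \<Rightarrow> case inv pos j of (e, k) \<Rightarrow>
      if d = ord0 then (if e = ord0 then k \<in> Y else e = ord1 \<and> x k)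
      else d \<in> C \<and> nxt e = d \<and> x j)"
  have f_zero: "slice (slice (f x) ord0) ord0 = (\<lambda>k. k \<in> Y)" "slice (slice (f x) ord0) ord1 = x" for x
    by (auto simp: slice_def f_def)
  have f_C: "slice (slice (f x) d) e = slice x e" if "d \<noteq> ord0" "d \<in> C" "nxt e = d" for x d e
    using that by (auto simp: slice_def f_def)
  have f_else: "slice (slice (f x) d) e = (\<lambda>_. False)"
    if "d \<noteq> ord0" "\<not> (d \<in> C \<and> nxt e = d)" for x d e
    using that by (auto simp: slice_def f_def)
  have slice_eqI: "u = v" if "\<And>e. slice u e = slice v e" for u v :: "'k \<Rightarrow> bool"
  proof
    fix i show "u i = v i"
      by (rule pos_cases[of i]) (use that in \<open>metis slice_def\<close>)
  qed
  have "bitwise_borel cantor_topology f"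
    unfolding bitwise_borel_def
  proof
    fix i :: 'k
    have T: "topspace (cantor_topology :: ('k \<Rightarrow> bool) topology) = UNIV" by simp
    have bit: "borel_pred cantor_topology TYPE('k) (\<lambda>x :: 'k \<Rightarrow> bool. x j)" for j
      using bitwise_borel_id unfolding bitwise_borel_def by blast
    obtain d j e k where *: "inv pos i = (d, j)" "inv pos j = (e, k)" by (meson surj_pair)
    show "borel_pred cantor_topology TYPE('k) (\<lambda>x. f x i)"
    proof (cases "d = ord0")
      case True
      then have "f x i \<longleftrightarrow> (e = ord0 \<and> k \<in> Y) \<or> ((e \<noteq> ord0 \<and> e = ord1) \<and> x k)" for x
        by (simp add: f_def *)
      then show ?thesis by (simp only:) (intro borel_disj[OF T] borel_conj[OF T] bit borel_const[OF T])
    next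
      case False
      then have "f x i \<longleftrightarrow> (d \<in> C \<and> nxt e = d) \<and> x j" for x
        by (simp add: f_def *)
      then show ?thesis by (simp only:) (intro borel_conj[OF T] bit borel_const[OF T])
    qed
  qed
  then have "borel_function f"
    unfolding borel_function_def using borel_in[of cantor_topology f]
    by (auto simp: borel_pred_def vimage_def intro: borel_sets_of.open_set)
  moreover have "(x, y) \<in> embedded_rel Y \<longleftrightarrow> (f x, f y) \<in> embedded_rel X" for x y
  proof
    assume xy: "(x, y) \<in> embedded_rel Y"
    have "(slice (f x) d, slice (f y) d) \<in> tower d" for d
    proof (cases "d = ord0")
      case True
      then show ?thesis using xy by (simp add: tower_base f_zero embedded_rel_def)
    next
      case False
      have "(slice (slice (f x) d) e, slice (slice (f y) d) e) \<in> tower e" for e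
        using False xy by (cases "d \<in> C \<and> nxt e = d") (auto simp: f_C f_else embedded_rel_def tower_refl)
      moreover have "slice (slice (f x) d) d = slice (slice (f y) d) d"
      proof -
        have "nxt d \<noteq> d" using nxt(2)[of d] by auto
        then show ?thesis using False by (simp add: f_else)
      qed
      moreover have "(u, u) \<in> ideal_rel P" for u and P :: "('k \<Rightarrow> bool) set"
        using equiv_ideal_rel[of P] by (auto simp: equiv_def refl_on_def)
      ultimately show ?thesis using False by (simp add: tower_above)
    qed
    moreover have "\<exists>\<alpha><\<beta>. \<forall>d. \<alpha> \<le> d \<and> d < \<beta> \<longrightarrow> slice (f x) d = slice (f y) d"
      if \<beta>: "cofinality_omega \<beta>" "\<beta> \<in> X" for \<beta>
    proof -
      \<comment> \<open>Apart from the slice 0 only slices with index in C can differ. If they are bounded below \<beta> there is nothing to prove;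
        otherwise \<beta> is a limit of elements of C, and thus in C and in Y.\<close>
      have "\<exists>a<\<beta>. \<forall>d e. a < d \<and> d < \<beta> \<and> d \<in> C \<and> nxt e = d \<longrightarrow> slice x e = slice y e"
      proof (cases "\<exists>a<\<beta>. \<forall>d. a < d \<and> d < \<beta> \<longrightarrow> d \<notin> C")
        case True
        then show ?thesis by blast
      next
        case False
        have "\<beta> \<in> C"
        proof -
          obtain \<gamma> :: "nat \<Rightarrow> 'k" where \<gamma>: "strict_mono \<gamma>" "(LEAST s. \<forall>i. \<gamma> i \<le> s) = \<beta>"
            using \<beta>(1) unfolding cofinality_omega_def by blast
          have "\<exists>s :: nat \<Rightarrow> 'k. \<forall>n. (s n < \<beta> \<and> s n \<in> C \<and> \<gamma> n < s n) \<and> s n < s (Suc n)"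
          proof (rule dependent_nat_choice)
            show "\<exists>x<\<beta>. x \<in> C \<and> \<gamma> 0 < x" using False cofinal_sequence(1)[OF \<gamma>] by blast
            fix x n assume "x < \<beta> \<and> x \<in> C \<and> \<gamma> n < x"
            then have "max x (\<gamma> (Suc n)) < \<beta>" using cofinal_sequence(1)[OF \<gamma>] by simp
            then obtain d where "max x (\<gamma> (Suc n)) < d" "d < \<beta>" "d \<in> C" using False by blast
            then show "\<exists>y. (y < \<beta> \<and> y \<in> C \<and> \<gamma> (Suc n) < y) \<and> x < y" by auto
          qed
          then obtain s :: "nat \<Rightarrow> 'k" where s: "\<And>n. s n < \<beta>" "\<And>n. s n \<in> C" "\<And>n. \<gamma> n < s n" "\<And>n. s n < s (Suc n)"
            by blast
          have "strict_mono s" using s(4) by (simp add: strict_mono_Suc_iff)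
          moreover have "(LEAST b. \<forall>i. s i \<le> b) = \<beta>"
          proof (rule least_bound_sequence[OF \<open>strict_mono s\<close> s(1)])
            fix a assume "a < \<beta>"
            then obtain i where "a < \<gamma> i" using cofinal_sequence(2)[OF \<gamma>] by blast
            then show "\<exists>i. a < s i" using s(3)[of i] by (meson order_less_trans)
          qed
          ultimately show ?thesis using C(1) s(2) unfolding omega_closed_def by blast
        qed
        then have "\<beta> \<in> Y" using disjoint \<beta> by blast
        then obtain a where a: "a < \<beta>" "\<forall>d. a \<le> d \<and> d < \<beta> \<longrightarrow> slice x d = slice y d"
          using xy \<beta>(1) unfolding embedded_rel_def tail_rel_def by blast
        \<comment> \<open>Beyond d0 an element of C collects only slices with index at least d0, hence above a.\<close>
        obtain d0 where d0: "a < d0" "d0 < \<beta>" "d0 \<in> C" using False a(1) by blast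
        have "slice x e = slice y e" if "d0 < d" "d < \<beta>" "d \<in> C" "nxt e = d" for d e
        proof -
          have "\<not> e < d0" using nxt_le[of d0 e] d0 that by auto
          then have "a \<le> e" using d0 by auto
          moreover have "e < \<beta>" using nxt(2)[of e] that by auto
          ultimately show ?thesis using a by blast
        qed
        then show ?thesis using d0 by blast
      qed
      then obtain a where a: "a < \<beta>"
        "\<And>d e. a < d \<Longrightarrow> d < \<beta> \<Longrightarrow> d \<in> C \<Longrightarrow> nxt e = d \<Longrightarrow> slice x e = slice y e" by blast
      obtain a' where a': "a < a'" "a' < \<beta>" using cofinality_omega_limit[OF \<beta>(1) a(1)] by blast
      have "slice (f x) d = slice (f y) d" if d: "a' \<le> d" "d < \<beta>" for d
      proof (rule slice_eqI)
        fix e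
        have "a < d" using a' d by auto
        moreover from this have "d \<noteq> ord0" by auto
        ultimately show "slice (slice (f x) d) e = slice (slice (f y) d) e"
          using a(2)[of d e] d by (cases "d \<in> C \<and> nxt e = d") (auto simp: f_C f_else)
      qed
      then show ?thesis using a' by blast
    qed
    ultimately show "(f x, f y) \<in> embedded_rel X" unfolding embedded_rel_def tail_rel_def by blast
  next
    assume fxy: "(f x, f y) \<in> embedded_rel X"
    have "(slice x e, slice y e) \<in> tower e" for e
    proof -
      have "nxt e \<noteq> ord0" using nxt(2)[of e] by (metis not_less_ord0)
      then have "(slice (slice (f x) (nxt e)) e, slice (slice (f y) (nxt e)) e) \<in> tower e"
      proof -
        have "(slice (f x) (nxt e), slice (f y) (nxt e)) \<in> tower (nxt e)"
          using fxy unfolding embedded_rel_def by blast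
        then show ?thesis using nxt(2)[of e] \<open>nxt e \<noteq> ord0\<close> by (simp add: tower_above)
      qed
      then show ?thesis using \<open>nxt e \<noteq> ord0\<close> nxt(1) by (simp add: f_C)
    qed
    moreover have "(x, y) \<in> tail_rel (\<lambda>k. k \<in> Y)"
    proof -
      have "(slice (f x) ord0, slice (f y) ord0) \<in> tower ord0"
        using fxy unfolding embedded_rel_def by blast
      then show ?thesis by (simp add: tower_base f_zero)
    qed
    ultimately show "(x, y) \<in> embedded_rel Y" unfolding embedded_rel_def by blast
  qed
  ultimately show ?thesis unfolding borel_reducible_def by blast
qed

end

section \<open>Category and generic points\<close>

definition open_dense :: "('k::wellorder \<Rightarrow> bool) set \<Rightarrow> bool" where
  "open_dense D \<longleftrightarrow> (\<forall>x\<in>D. \<exists>a. \<forall>y. agree a x y \<longrightarrow> y \<in> D) \<and> (\<forall>x a. \<exists>y. agree a x y \<and> y \<in> D)"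

text \<open>
  Intersections of \<open>\<kappa>\<close> many open dense sets, the notion of category that belongs to \<open>\<kappa>\<close>-Borel sets.
\<close>

definition comeager :: "('k::wellorder \<Rightarrow> bool) set \<Rightarrow> bool" where
  "comeager A \<longleftrightarrow> (\<exists>D :: 'k \<Rightarrow> _. (\<forall>i. open_dense (D i)) \<and> (\<Inter>i. D i) \<subseteq> A)"

text \<open>
  Changing the initial segment is a homeomorphism between basic sets, so it preserves category.
\<close>

definition splice :: "'k::wellorder \<Rightarrow> ('k \<Rightarrow> 'v) \<Rightarrow> ('k \<Rightarrow> 'v) \<Rightarrow> 'k \<Rightarrow> 'v" where
  "splice a y x = (\<lambda>i. if i < a then y i else x i)"

lemma agree_splice [simp]: "agree a (splice a y x) y" "agree a y (splice a y x)"
  by (simp_all add: splice_def agree_def)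

context kappa begin

text \<open>
  Constructions of length \<open>\<kappa>\<close> with conditions of length less than \<open>\<kappa>\<close>. A condition is a length \<open>a\<close>
  together with a function \<open>x\<close> of which only the part below \<open>a\<close> counts; \<open>L\<close> says which conditions are
  allowed and \<open>G i\<close> is the \<open>i\<close>-th of \<open>\<kappa>\<close> many requirements. If each requirement can be met by
  extending an allowed condition and limits of allowed conditions are allowed, then one
  function meets all requirements. The Baire category theorem is the case in which all conditions are allowed.
\<close>

lemma generic_limit:
  fixes L :: "'k \<Rightarrow> ('k \<Rightarrow> 'v) \<Rightarrow> bool" and G :: "'k \<Rightarrow> 'k \<Rightarrow> ('k \<Rightarrow> 'v) \<Rightarrow> bool"
  assumes local_L: "\<And>a x y. L a x \<Longrightarrow> agree a x y \<Longrightarrow> L a y"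
    and local_G: "\<And>i a x y. G i a x \<Longrightarrow> agree a x y \<Longrightarrow> G i a y"
    and limit: "\<And>A b x. A \<noteq> {} \<Longrightarrow> (\<And>a. a \<in> A \<Longrightarrow> L a x \<and> a \<le> b) \<Longrightarrow>
      (\<And>c. c < b \<Longrightarrow> \<exists>a\<in>A. c < a) \<Longrightarrow> L b x"
    and step: "\<And>i a x. L a x \<Longrightarrow> \<exists>b y. a \<le> b \<and> agree a x y \<and> L b y \<and> G i b y"
    and start: "L a0 x0"
  shows "\<exists>z. agree a0 x0 z \<and> (\<forall>i. \<exists>a. L a z \<and> G i a z)"
proof -
  \<comment> \<open>The function approximated by the stages in J, and the supremum of their lengths.\<close>
  define glue :: "('k \<Rightarrow> 'k \<times> ('k \<Rightarrow> 'v)) \<Rightarrow> 'k set \<Rightarrow> 'k \<Rightarrow> 'v" where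
    "glue = (\<lambda>S J i. if \<exists>j\<in>J. i < fst (S j) then snd (S (SOME j. j \<in> J \<and> i < fst (S j))) i else x0 i)"
  define height :: "('k \<Rightarrow> 'k \<times> ('k \<Rightarrow> 'v)) \<Rightarrow> 'k set \<Rightarrow> 'k" where
    "height = (\<lambda>S J. LEAST s. \<forall>a \<in> insert a0 ((\<lambda>j. fst (S j)) ` J). a \<le> s)"
  define pick where "pick = (\<lambda>i a x. SOME p. a \<le> fst p \<and> agree a x (snd p) \<and> L (fst p) (snd p) \<and> G i (fst p) (snd p))"
  define F where "F = (\<lambda>S i. pick i (height S {..<i}) (glue S {..<i}))"
  define S where "S = wfrec {(x, y). x < y} F"
  have S_eq: "S i = pick i (height S {..<i}) (glue S {..<i})" for i
  proof -
    let ?c = "cut S {(x, y). x < y} i"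
    have c: "?c j = S j" if "j < i" for j using that by (simp add: cut_apply)
    have "(\<lambda>j. fst (?c j)) ` {..<i} = (\<lambda>j. fst (S j)) ` {..<i}"
      using c by (intro image_cong) simp_all
    then have "height ?c {..<i} = height S {..<i}" by (simp only: height_def)
    moreover have "glue ?c {..<i} = glue S {..<i}"
    proof
      fix k
      have "(\<exists>j\<in>{..<i}. k < fst (?c j)) \<longleftrightarrow> (\<exists>j\<in>{..<i}. k < fst (S j))"
        using c by simp
      moreover have eq: "(\<lambda>j. j \<in> {..<i} \<and> k < fst (?c j)) = (\<lambda>j. j \<in> {..<i} \<and> k < fst (S j))"
        using c by auto
      moreover have "?c (SOME j. j \<in> {..<i} \<and> k < fst (S j)) = S (SOME j. j \<in> {..<i} \<and> k < fst (S j))"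
        if "\<exists>j\<in>{..<i}. k < fst (S j)"
      proof (rule c)
        have "\<exists>j. j \<in> {..<i} \<and> k < fst (S j)" using that by blast
        from someI_ex[OF this] show "(SOME j. j \<in> {..<i} \<and> k < fst (S j)) < i" by simp
      qed
      ultimately show "glue ?c {..<i} k = glue S {..<i} k"
        unfolding glue_def by simp
    qed
    moreover have "S i = F ?c i" unfolding S_def by (rule wfrec) (rule wf)
    ultimately show ?thesis by (simp add: F_def)
  qed
  \<comment> \<open>The invariant of the recursion: stage i is allowed, meets requirement i and extends all earlier stages.\<close>
  define P where "P = (\<lambda>i. L (fst (S i)) (snd (S i)) \<and> G i (fst (S i)) (snd (S i)) \<and>
    a0 \<le> fst (S i) \<and> agree a0 x0 (snd (S i)) \<and>
    (\<forall>j<i. fst (S j) \<le> fst (S i) \<and> agree (fst (S j)) (snd (S j)) (snd (S i))))"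
  have glue_start: "agree a0 x0 (glue S J)" if P: "\<And>j. j \<in> J \<Longrightarrow> P j" for J
    unfolding agree_def
  proof (intro allI impI)
    fix k assume k: "k < a0"
    show "x0 k = glue S J k"
    proof (cases "\<exists>j\<in>J. k < fst (S j)")
      case True
      define m where "m = (SOME j. j \<in> J \<and> k < fst (S j))"
      have "\<exists>j. j \<in> J \<and> k < fst (S j)" using True by blast
      from someI_ex[OF this] have m: "m \<in> J" unfolding m_def by simp
      have "glue S J k = snd (S m) k" unfolding glue_def m_def using True by simp
      then show ?thesis using P[OF m] k unfolding P_def agree_def by simp
    qed (simp add: glue_def)
  qed
  have glue: "agree (fst (S j)) (snd (S j)) (glue S J)" if P: "\<And>j. j \<in> J \<Longrightarrow> P j" and j: "j \<in> J" for J j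
    unfolding agree_def
  proof (intro allI impI)
    fix k assume k: "k < fst (S j)"
    define m where "m = (SOME j. j \<in> J \<and> k < fst (S j))"
    have "\<exists>j. j \<in> J \<and> k < fst (S j)" using k j by blast
    from someI_ex[OF this] have m: "m \<in> J" "k < fst (S m)" unfolding m_def by simp_all
    have "glue S J k = snd (S m) k" unfolding glue_def m_def using k j by auto
    moreover have "snd (S m) k = snd (S j) k"
    proof (cases m j rule: linorder_cases)
      case less then show ?thesis using P[OF j] m(2) unfolding P_def agree_def by simp
    next
      case greater then show ?thesis using P[OF m(1)] k unfolding P_def agree_def by simp
    qed simp
    ultimately show "snd (S j) k = glue S J k" by simp
  qed
  have P: "P i" for i
  proof (induction i rule: less_induct)
    case (less i)
    let ?J = "{..<i}" and ?A = "insert a0 ((\<lambda>j. fst (S j)) ` {..<i})"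
    let ?b = "height S ?J" and ?z = "glue S ?J"
    have IH: "\<And>j. j \<in> ?J \<Longrightarrow> P j" using less by simp
    obtain s where "\<forall>j<i. fst (S j) < s" using bounded_initial by blast
    then have "\<forall>a\<in>?A. a \<le> max a0 s" by (auto intro: order_less_imp_le max.coboundedI2)
    then have ub: "\<forall>a\<in>?A. a \<le> ?b" unfolding height_def by (rule LeastI)
    have "L ?b ?z"
    proof (rule limit[of ?A])
      show "?A \<noteq> {}" by simp
      show "L a ?z \<and> a \<le> ?b" if a: "a \<in> ?A" for a
      proof
        show "a \<le> ?b" using ub a by blast
        show "L a ?z"
        proof (cases "a = a0")
          case True
          then show ?thesis using local_L[OF start glue_start[of ?J]] IH by simp
        next
          case False
          then obtain j where j: "j \<in> ?J" "a = fst (S j)" using a by blast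
          have "L (fst (S j)) (snd (S j))" using IH[OF j(1)] unfolding P_def by blast
          from local_L[OF this glue[of ?J, OF IH j(1)]] show ?thesis by (simp add: j(2))
        qed
      qed
      show "\<exists>a\<in>?A. c < a" if "c < ?b" for c
      proof -
        have "\<not> (\<forall>a\<in>?A. a \<le> c)" using that not_less_Least unfolding height_def by blast
        then show ?thesis by (meson not_le)
      qed
    qed
    from step[OF this] have "\<exists>p. ?b \<le> fst p \<and> agree ?b ?z (snd p) \<and> L (fst p) (snd p) \<and> G i (fst p) (snd p)"
      by simp
    from someI_ex[OF this] have new: "?b \<le> fst (S i)" "agree ?b ?z (snd (S i))"
        "L (fst (S i)) (snd (S i))" "G i (fst (S i)) (snd (S i))"
      unfolding S_eq[of i] pick_def by auto
    have a0: "a0 \<le> ?b" using ub by simp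
    have "fst (S j) \<le> fst (S i) \<and> agree (fst (S j)) (snd (S j)) (snd (S i))" if "j < i" for j
    proof -
      have j: "j \<in> ?J" using that by simp
      then have le: "fst (S j) \<le> ?b" using ub by simp
      show ?thesis using agree_trans[OF glue[of ?J, OF IH j] agree_mono[OF new(2) le]] le new(1) by simp
    qed
    moreover have "agree a0 x0 (snd (S i))"
      using agree_trans[OF glue_start[of ?J, OF IH] agree_mono[OF new(2) a0]] .
    ultimately show ?case unfolding P_def using new a0 by simp
  qed
  define z where "z = glue S UNIV"
  have "agree a0 x0 z" unfolding z_def using glue_start P by blast
  moreover have "\<exists>a. L a z \<and> G i a z" for i
  proof -
    have "agree (fst (S i)) (snd (S i)) z" unfolding z_def using glue P by blast
    moreover have "L (fst (S i)) (snd (S i))" "G i (fst (S i)) (snd (S i))"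
      using P[of i] unfolding P_def by blast+
    ultimately show ?thesis using local_L local_G by blast
  qed
  ultimately show ?thesis by blast
qed

lemma baire:
  assumes "comeager (A :: ('k \<Rightarrow> bool) set)"
  shows "\<exists>y\<in>A. agree a x y"
proof -
  obtain D :: "'k \<Rightarrow> ('k \<Rightarrow> bool) set" where D: "\<And>i. open_dense (D i)" "(\<Inter>i. D i) \<subseteq> A"
    using assms unfolding comeager_def by blast
  have "\<exists>z. agree a x z \<and> (\<forall>i. \<exists>b. True \<and> (\<forall>w. agree b z w \<longrightarrow> w \<in> D i))"
  proof (rule generic_limit)
    fix i b and x :: "'k \<Rightarrow> bool"
    obtain y where y: "agree b x y" "y \<in> D i" using D(1) unfolding open_dense_def by blast
    obtain c where c: "\<forall>w. agree c y w \<longrightarrow> w \<in> D i" using D(1) y(2) unfolding open_dense_def by blast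
    have "\<forall>w. agree (max b c) y w \<longrightarrow> w \<in> D i" using c agree_mono[of "max b c" y _ c] by simp
    then show "\<exists>b' y. b \<le> b' \<and> agree b x y \<and> True \<and> (\<forall>w. agree b' y w \<longrightarrow> w \<in> D i)"
      using y(1) by (intro exI[of _ "max b c"] exI[of _ y]) simp
  next
    fix i b and x y :: "'k \<Rightarrow> bool"
    assume "\<forall>w. agree b x w \<longrightarrow> w \<in> D i" "agree b x y"
    then show "\<forall>w. agree b y w \<longrightarrow> w \<in> D i" using agree_trans by blast
  qed simp_all
  then obtain z where z: "agree a x z" "\<And>i. z \<in> D i" using agree_refl by blast
  then show ?thesis using D(2) by blast
qed

lemma comeager_INT:
  assumes "\<And>j::'k. comeager (A j :: ('k \<Rightarrow> bool) set)"
  shows "comeager (\<Inter>j. A j)"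
proof -
  have "\<exists>D. \<forall>j. (\<forall>i::'k. open_dense (D j i)) \<and> (\<Inter>i. D j i) \<subseteq> A j"
    using assms unfolding comeager_def by (intro choice) blast
  then obtain D where D: "\<And>j i. open_dense (D j (i :: 'k))" "\<And>j. (\<Inter>i. D j i) \<subseteq> A j"
    by blast
  define D' where "D' = (\<lambda>k. D (fst (inv pos k)) (snd (inv pos k)))"
  have "(\<Inter>k. D' k) \<subseteq> A j" for j
  proof
    fix x assume "x \<in> (\<Inter>k. D' k)"
    then have "x \<in> D' (pos (j, i))" for i by blast
    then have "x \<in> D j i" for i by (simp add: D'_def)
    then show "x \<in> A j" using D(2) by blast
  qed
  then show ?thesis unfolding comeager_def using D(1) by (intro exI[of _ D']) (auto simp: D'_def)
qed

lemma comeager_Int: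
  assumes "comeager (A :: ('k \<Rightarrow> bool) set)" "comeager B"
  shows "comeager (A \<inter> B)"
proof -
  have "comeager (\<Inter>j::'k. if j = ord0 then A else B)"
    by (rule comeager_INT) (simp add: assms)
  moreover have "(\<Inter>j::'k. if j = ord0 then A else B) = A \<inter> B"
  proof (intro set_eqI iffI)
    fix x assume "x \<in> (\<Inter>j::'k. if j = ord0 then A else B)"
    then have "x \<in> (if j = ord0 then A else B)" for j :: 'k by blast
    from this[of ord0] this[of ord1] show "x \<in> A \<inter> B" by simp
  qed simp
  ultimately show ?thesis by simp
qed

lemma comeager_open_dense: "open_dense D \<Longrightarrow> comeager (D :: ('k \<Rightarrow> bool) set)"
  unfolding comeager_def by (intro exI[of _ "\<lambda>_. D"]) simp

lemma comeager_splice: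
  assumes "comeager (A :: ('k \<Rightarrow> bool) set)"
  shows "comeager {x. splice a y x \<in> A}"
proof -
  obtain D :: "'k \<Rightarrow> ('k \<Rightarrow> bool) set" where D: "\<And>i. open_dense (D i)" "(\<Inter>i. D i) \<subseteq> A"
    using assms unfolding comeager_def by blast
  have "open_dense {x. splice a y x \<in> D i}" for i
    unfolding open_dense_def
  proof (intro conjI ballI allI)
    fix x assume "x \<in> {x. splice a y x \<in> D i}"
    then obtain b where b: "\<forall>w. agree b (splice a y x) w \<longrightarrow> w \<in> D i"
      using D(1) unfolding open_dense_def by blast
    have "agree b (splice a y x) (splice a y w)" if "agree b x w" for w
      using that by (simp add: agree_def splice_def)
    then show "\<exists>b. \<forall>w. agree b x w \<longrightarrow> w \<in> {x. splice a y x \<in> D i}" using b by blast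
  next
    fix x b
    obtain w where w: "agree (max a b) (splice a y x) w" "w \<in> D i"
      using D(1) unfolding open_dense_def by blast
    have "splice a y (splice (max a b) x w) = w"
    proof
      fix k
      show "splice a y (splice (max a b) x w) k = w k"
        using w(1) unfolding agree_def splice_def by (cases "k < max a b") (auto simp: less_max_iff_disj)
    qed
    moreover have "agree b x (splice (max a b) x w)"
      by (simp add: agree_def splice_def less_max_iff_disj)
    ultimately show "\<exists>w. agree b x w \<and> w \<in> {x. splice a y x \<in> D i}"
      using w(2) by (intro exI[of _ "splice (max a b) x w"]) simp
  qed
  then show ?thesis unfolding comeager_def
    using D(2) by (intro exI[of _ "\<lambda>i. {x. splice a y x \<in> D i}"]) blast
qed

text \<open>
  Both points can be generic although they agree outside their prescribed initial segments, by
  applying the Baire theorem to a comeager set and its preimage under a change of the initial segment.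
\<close>

lemma generic_pair:
  assumes "comeager (A :: ('k \<Rightarrow> bool) set)"
  shows "\<exists>x\<in>A. \<exists>y\<in>A. agree a x0 x \<and> agree a y0 y \<and> (\<forall>k. \<not> k < a \<longrightarrow> x k = y k)"
proof -
  obtain x where x: "x \<in> A" "splice a y0 x \<in> A" "agree a x0 x"
    using baire[OF comeager_Int[OF assms comeager_splice[OF assms, of a y0]]] by blast
  moreover have "\<forall>k. \<not> k < a \<longrightarrow> x k = splice a y0 x k" by (simp add: splice_def)
  ultimately show ?thesis by (intro bexI[of _ x] bexI[of _ "splice a y0 x"] conjI agree_splice)
qed

text \<open>
  The Baire property, in a form that is visibly closed under complements.
\<close>

definition relatively_clopen :: "('k \<Rightarrow> bool) set \<Rightarrow> bool" where
  "relatively_clopen B \<longleftrightarrow>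
    (\<exists>A. comeager A \<and> (\<forall>x\<in>A. \<exists>a. \<forall>y\<in>A. agree a x y \<longrightarrow> (y \<in> B \<longleftrightarrow> x \<in> B)))"

text \<open>
  An open set and the interior of its complement together are dense.
\<close>

lemma relatively_clopen_open:
  assumes U: "\<And>x. x \<in> U \<Longrightarrow> \<exists>a. \<forall>y. agree a x y \<longrightarrow> y \<in> U"
  shows "relatively_clopen U"
proof -
  let ?V = "{x. \<exists>a. \<forall>y. agree a x y \<longrightarrow> y \<notin> U}"
  have V: "\<exists>a. \<forall>y. agree a x y \<longrightarrow> y \<in> ?V" if V: "x \<in> ?V" for x
  proof -
    obtain a where a: "\<forall>y. agree a x y \<longrightarrow> y \<notin> U" using V by blast
    have "y \<in> ?V" if y: "agree a x y" for y
      using a agree_trans[OF y] by blast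
    then show ?thesis by blast
  qed
  have "open_dense (U \<union> ?V)"
    unfolding open_dense_def
  proof (intro conjI ballI allI)
    fix x assume "x \<in> U \<union> ?V"
    then show "\<exists>a. \<forall>y. agree a x y \<longrightarrow> y \<in> U \<union> ?V"
    proof
      assume "x \<in> U" then show ?thesis using U[of x] by blast
    next
      assume "x \<in> ?V" then show ?thesis using V[of x] by blast
    qed
  next
    fix x a
    show "\<exists>y. agree a x y \<and> y \<in> U \<union> ?V" using agree_refl[of a x] by blast
  qed
  then have "comeager (U \<union> ?V)" by (rule comeager_open_dense)
  moreover have "\<exists>a. \<forall>y\<in>U \<union> ?V. agree a x y \<longrightarrow> (y \<in> U \<longleftrightarrow> x \<in> U)" if x: "x \<in> U \<union> ?V" for x
    using x
  proof
    assume "x \<in> U" then show ?thesis using U[of x] by blast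
  next
    assume "x \<in> ?V"
    then obtain a where "\<forall>y. agree a x y \<longrightarrow> y \<notin> U" by blast
    then show ?thesis using agree_refl[of a x] by blast
  qed
  ultimately show ?thesis unfolding relatively_clopen_def by (intro exI[of _ "U \<union> ?V"]) simp
qed

lemma relatively_clopen_cong:
  assumes A: "comeager A" and eq: "\<And>x. x \<in> A \<Longrightarrow> x \<in> B \<longleftrightarrow> x \<in> U" and U: "relatively_clopen U"
  shows "relatively_clopen B"
proof -
  obtain A' where A': "comeager A'" "\<And>x. x \<in> A' \<Longrightarrow> \<exists>a. \<forall>y\<in>A'. agree a x y \<longrightarrow> (y \<in> U \<longleftrightarrow> x \<in> U)"
    using U unfolding relatively_clopen_def by blast
  have all: "\<forall>x\<in>A \<inter> A'. \<exists>a. \<forall>y\<in>A \<inter> A'. agree a x y \<longrightarrow> (y \<in> B \<longleftrightarrow> x \<in> B)"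
  proof
    fix x assume x: "x \<in> A \<inter> A'"
    then obtain a where a: "\<forall>y\<in>A'. agree a x y \<longrightarrow> (y \<in> U \<longleftrightarrow> x \<in> U)" using A'(2) by blast
    have "y \<in> B \<longleftrightarrow> x \<in> B" if y: "y \<in> A \<inter> A'" "agree a x y" for y
      using a eq[of x] eq[of y] x y by blast
    then show "\<exists>a. \<forall>y\<in>A \<inter> A'. agree a x y \<longrightarrow> (y \<in> B \<longleftrightarrow> x \<in> B)" by blast
  qed
  show ?thesis unfolding relatively_clopen_def
    by (rule exI[of _ "A \<inter> A'"], rule conjI[OF comeager_Int[OF A A'(1)] all])
qed

text \<open>
  On the intersection of the comeager sets given by the members, the union coincides with an open set.
\<close>

lemma relatively_clopen_UN:
  assumes g: "\<And>j::'k. relatively_clopen (g j)"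
  shows "relatively_clopen (\<Union>j. g j)"
proof -
  have "\<forall>j. \<exists>A. comeager A \<and> (\<forall>x\<in>A. \<exists>a. \<forall>y\<in>A. agree a x y \<longrightarrow> (y \<in> g j \<longleftrightarrow> x \<in> g j))"
    using g unfolding relatively_clopen_def by blast
  then have "\<exists>A. \<forall>j. comeager (A j) \<and>
      (\<forall>x\<in>A j. \<exists>a. \<forall>y\<in>A j. agree a x y \<longrightarrow> (y \<in> g j \<longleftrightarrow> x \<in> g j))"
    by (rule choice)
  then obtain A where A: "\<And>j. comeager (A j)"
      "\<And>j x. x \<in> A j \<Longrightarrow> \<exists>a. \<forall>y\<in>A j. agree a x y \<longrightarrow> (y \<in> g j \<longleftrightarrow> x \<in> g j)" by blast
  let ?A = "\<Inter>j. A j"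
  let ?U = "{x. \<exists>a j. \<forall>y\<in>?A. agree a x y \<longrightarrow> y \<in> g j}"
  show ?thesis
  proof (rule relatively_clopen_cong[where A = ?A and U = ?U])
    show "comeager ?A" using A(1) by (rule comeager_INT)
    show "relatively_clopen ?U"
    proof (rule relatively_clopen_open)
      fix x assume "x \<in> ?U"
      then obtain a j where a: "\<forall>y\<in>?A. agree a x y \<longrightarrow> y \<in> g j" by blast
      have "y \<in> ?U" if y: "agree a x y" for y
        using a agree_trans[OF y] by blast
      then show "\<exists>a. \<forall>y. agree a x y \<longrightarrow> y \<in> ?U" by blast
    qed
    fix x assume x: "x \<in> ?A"
    show "x \<in> (\<Union>j. g j) \<longleftrightarrow> x \<in> ?U"
    proof
      assume "x \<in> (\<Union>j. g j)"
      then obtain j where j: "x \<in> g j" by blast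
      obtain a where "\<forall>y\<in>A j. agree a x y \<longrightarrow> (y \<in> g j \<longleftrightarrow> x \<in> g j)" using A(2) x by blast
      then have "\<forall>y\<in>?A. agree a x y \<longrightarrow> y \<in> g j" using j by blast
      then show "x \<in> ?U" by blast
    next
      assume "x \<in> ?U"
      then obtain a j where "\<forall>y\<in>?A. agree a x y \<longrightarrow> y \<in> g j" by blast
      then have "x \<in> g j" using x agree_refl[of a x] by blast
      then show "x \<in> (\<Union>j. g j)" by blast
    qed
  qed
qed

lemma relatively_clopen_Compl: "relatively_clopen B \<Longrightarrow> relatively_clopen (- B)"
  unfolding relatively_clopen_def by simp

lemma borel_relatively_clopen:
  assumes "B \<in> borel_sets_of (ord_rel :: 'k rel) (cantor_topology :: ('k \<Rightarrow> bool) topology)"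
  shows "relatively_clopen B"
  using assms
proof induction
  case (open_set U)
  then show ?case by (intro relatively_clopen_open) (simp add: openin_cantor)
next
  case (union \<A>)
  show ?case
  proof (cases "\<A> = {}")
    case True
    then show ?thesis using relatively_clopen_open[of "{}"] by simp
  next
    case False
    then obtain g :: "'k \<Rightarrow> _" where "\<A> = range g" using surjection_if_small union(2) by blast
    then show ?thesis using relatively_clopen_UN[of g] union(1) by blast
  qed
next
  case (inter \<A>)
  then obtain g :: "'k \<Rightarrow> _" where g: "\<A> = range g" using surjection_if_small by blast
  have "relatively_clopen (- (\<Union>j. - g j))"
    using inter(1) g by (intro relatively_clopen_Compl relatively_clopen_UN) blast
  moreover have "- (\<Union>j. - g j) = \<Inter>\<A>" using g by auto
  ultimately show ?case by simp
next
  case (compl B)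
  then show ?case using relatively_clopen_Compl[of B] by (simp add: Compl_eq_Diff_UNIV)
qed

definition continuous_in :: "('k \<Rightarrow> bool) set \<Rightarrow> (('k \<Rightarrow> bool) \<Rightarrow> 'k \<Rightarrow> bool) \<Rightarrow> bool" where
  "continuous_in A f \<longleftrightarrow> (\<forall>x\<in>A. \<forall>i. \<exists>a. \<forall>y\<in>A. agree a x y \<longrightarrow> f y i = f x i)"

text \<open>
  Only \<open>\<kappa>\<close> many Borel sets, one for each bit of the value, have to be made relatively clopen.
\<close>

lemma borel_function_continuous:
  assumes f: "borel_function (f :: ('k \<Rightarrow> bool) \<Rightarrow> 'k \<Rightarrow> bool)"
  shows "\<exists>A. comeager A \<and> continuous_in A f"
proof -
  have "relatively_clopen {x. f x i}" for i
  proof -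
    obtain a where "i < a" using no_greatest by blast
    then have "openin cantor_topology {y :: 'k \<Rightarrow> bool. y i}"
      unfolding openin_cantor by (auto simp: agree_def)
    then have "f -` {y. y i} \<in> borel_sets_of (ord_rel :: 'k rel) cantor_topology"
      using f unfolding borel_function_def by blast
    then show ?thesis using borel_relatively_clopen by (simp add: vimage_def)
  qed
  then have "\<forall>i. \<exists>A. comeager A \<and> (\<forall>x\<in>A. \<exists>a. \<forall>y\<in>A. agree a x y \<longrightarrow> f y i = f x i)"
    unfolding relatively_clopen_def by simp
  then have "\<exists>A. \<forall>i. comeager (A i) \<and> (\<forall>x\<in>A i. \<exists>a. \<forall>y\<in>A i. agree a x y \<longrightarrow> f y i = f x i)"
    by (rule choice)
  then obtain A where A: "\<And>i. comeager (A i)"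
      "\<And>i x. x \<in> A i \<Longrightarrow> \<exists>a. \<forall>y\<in>A i. agree a x y \<longrightarrow> f y i = f x i" by blast
  have "continuous_in (\<Inter>i. A i) f"
    unfolding continuous_in_def
  proof (intro ballI allI)
    fix x i assume "x \<in> (\<Inter>i. A i)"
    then obtain a where "\<forall>y\<in>A i. agree a x y \<longrightarrow> f y i = f x i" using A(2) by blast
    then show "\<exists>a. \<forall>y\<in>(\<Inter>i. A i). agree a x y \<longrightarrow> f y i = f x i" by blast
  qed
  then show ?thesis using comeager_INT[of A] A(1) by blast
qed

text \<open>
  The positions in the range of \<open>q\<close> carry a set of nodes, the difference of \<open>x\<close> and \<open>y\<close>. The
  difference can be made to code the element \<open>code x y\<close>, which depends on \<open>x\<close> and \<open>y\<close>
  themselves: since \<open>code\<close> is continuous, conditions on \<open>x\<close> and \<open>y\<close> decide longer and longer initial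
  segments of \<open>code x y\<close>, and a node is put into the difference only after it has been decided to lie on
  the branch \<open>code x y\<close>.
\<close>

lemma diagonal_pair:
  assumes A: "comeager A" and q: "inj (q :: 'k \<Rightarrow> 'k)"
    and continuous: "\<And>x y i. x \<in> A \<Longrightarrow> y \<in> A \<Longrightarrow>
      \<exists>a. \<forall>x'\<in>A. \<forall>y'\<in>A. agree a x x' \<and> agree a y y' \<longrightarrow> code x' y' i = (code x y i :: bool)"
  shows "\<exists>x\<in>A. \<exists>y\<in>A. agree a0 x0 x \<and> agree a0 x0 y \<and> (\<forall>i. i \<notin> range q \<longrightarrow> x i = y i) \<and>
    (\<forall>j. x (q j) \<noteq> y (q j) \<longrightarrow> on_branch j (code x y)) \<and> along (\<lambda>j. x (q j) \<noteq> y (q j)) (code x y)"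
proof -
  obtain D :: "'k \<Rightarrow> ('k \<Rightarrow> bool) set" where D: "\<And>i. open_dense (D i)" "(\<Inter>i. D i) \<subseteq> A"
    using A unfolding comeager_def by blast
  \<comment> \<open>The condition of length a decides that the node j lies on the coded branch.\<close>
  define forced where "forced = (\<lambda>j a x y. \<forall>x'\<in>A. \<forall>y'\<in>A. agree a x x' \<and> agree a y y' \<longrightarrow> on_branch j (code x' y'))"
  have forced_mono: "forced j b x' y'" if "forced j a x y" "a \<le> b" "agree a x x'" "agree a y y'" for j a b x y x' y'
    unfolding forced_def
  proof (intro ballI impI)
    fix u v assume uv: "u \<in> A" "v \<in> A" "agree b x' u \<and> agree b y' v"
    then have "agree a x u" "agree a y v"
      using that agree_trans agree_mono by blast+
    then show "on_branch j (code u v)" using that(1) uv unfolding forced_def by blast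
  qed
  define X :: "('k \<Rightarrow> bool \<times> bool) \<Rightarrow> 'k \<Rightarrow> bool" where "X = (\<lambda>z i. fst (z i))"
  define Y :: "('k \<Rightarrow> bool \<times> bool) \<Rightarrow> 'k \<Rightarrow> bool" where "Y = (\<lambda>z i. snd (z i))"
  define L where "L = (\<lambda>a z. a0 \<le> a \<and> agree a0 x0 (X z) \<and> agree a0 x0 (Y z) \<and>
    (\<forall>i<a. i \<notin> range q \<longrightarrow> X z i = Y z i) \<and>
    (\<forall>j. q j < a \<and> X z (q j) \<noteq> Y z (q j) \<longrightarrow> forced j a (X z) (Y z)))"
  define G where "G = (\<lambda>i a z. i < a \<and> (\<forall>w. agree a (X z) w \<longrightarrow> w \<in> D i) \<and> (\<forall>w. agree a (Y z) w \<longrightarrow> w \<in> D i) \<and>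
    (\<exists>j. q j < a \<and> X z (q j) \<noteq> Y z (q j) \<and> i \<le> j \<and> i \<le> node_length j))"
  have XY: "agree a (X z) (X z')" "agree a (Y z) (Y z')" if "agree a z z'" for a z z'
    using that by (simp_all add: agree_def X_def Y_def)
  have XY_at: "X z i = X z' i" "Y z i = Y z' i" if "agree a z z'" "i < a" for a z z' i
    using that by (simp_all add: agree_def X_def Y_def)
  have "\<exists>z. agree a0 (\<lambda>i. (x0 i, x0 i)) z \<and> (\<forall>i. \<exists>a. L a z \<and> G i a z)"
  proof (rule generic_limit)
    fix a z z' assume L: "L a z" and z: "agree a z z'"
    have "a0 \<le> a" using L unfolding L_def by blast
    then have "agree a0 z z'" using z agree_mono by blast
    then have "agree a0 x0 (X z')" "agree a0 x0 (Y z')"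
      using L XY[of a0 z z'] agree_trans unfolding L_def by blast+
    moreover have "forced j a (X z') (Y z')" if "q j < a" "X z' (q j) \<noteq> Y z' (q j)" for j
    proof (rule forced_mono[OF _ order_refl XY[OF z]])
      show "forced j a (X z) (Y z)" using L that XY_at[OF z that(1)] unfolding L_def by simp
    qed
    moreover have "X z' i = Y z' i" if "i < a" "i \<notin> range q" for i
      using L that XY_at[OF z that(1)] unfolding L_def by simp
    ultimately show "L a z'" using \<open>a0 \<le> a\<close> unfolding L_def by blast
  next
    fix i a z z' assume G: "G i a z" and z: "agree a z z'"
    obtain j where j: "q j < a" "X z (q j) \<noteq> Y z (q j)" "i \<le> j" "i \<le> node_length j"
      using G unfolding G_def by blast
    have "X z' (q j) \<noteq> Y z' (q j)" using j(2) XY_at[OF z j(1)] by simp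
    moreover have "\<forall>w. agree a (X z') w \<longrightarrow> w \<in> D i" "\<forall>w. agree a (Y z') w \<longrightarrow> w \<in> D i"
      using G agree_trans[OF XY(1)[OF z]] agree_trans[OF XY(2)[OF z]] unfolding G_def by blast+
    ultimately show "G i a z'" using G j unfolding G_def by blast
  next
    fix C b z
    assume C: "C \<noteq> {}" "\<And>a. a \<in> C \<Longrightarrow> L a z \<and> a \<le> b" "\<And>c. c < b \<Longrightarrow> \<exists>a\<in>C. c < a"
    obtain a where a: "a \<in> C" using C(1) by blast
    have "a0 \<le> a" "a \<le> b" using C(2)[OF a] unfolding L_def by blast+
    then have "a0 \<le> b" by simp
    moreover have "agree a0 x0 (X z)" "agree a0 x0 (Y z)" using C(2)[OF a] unfolding L_def by blast+
    moreover have "X z i = Y z i" if i: "i < b" "i \<notin> range q" for i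
    proof -
      obtain c where c: "c \<in> C" "i < c" using C(3)[OF i(1)] by blast
      then show ?thesis using C(2)[OF c(1)] i unfolding L_def by blast
    qed
    moreover have "forced j b (X z) (Y z)" if j: "q j < b" "X z (q j) \<noteq> Y z (q j)" for j
    proof -
      obtain c where c: "c \<in> C" "q j < c" using C(3)[OF j(1)] by blast
      then have "forced j c (X z) (Y z)" "c \<le> b" using C(2)[OF c(1)] j unfolding L_def by blast+
      then show ?thesis using forced_mono[of j c "X z" "Y z" b] agree_refl by blast
    qed
    ultimately show "L b z" unfolding L_def by blast
  next
    fix i a z assume L: "L a z"
    \<comment> \<open>First extend both conditions into the open dense set with number i, without new differences.\<close>
    obtain x1 where x1: "agree a (X z) x1" "x1 \<in> D i" using D(1) unfolding open_dense_def by blast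
    obtain a1 where a1: "\<forall>w. agree a1 x1 w \<longrightarrow> w \<in> D i" using D(1) x1(2) unfolding open_dense_def by blast
    define b1 where "b1 = max a a1"
    define y1 where "y1 = splice a (Y z) x1"
    obtain y2 where y2: "agree b1 y1 y2" "y2 \<in> D i" using D(1) unfolding open_dense_def by blast
    obtain a2 where a2: "\<forall>w. agree a2 y2 w \<longrightarrow> w \<in> D i" using D(1) y2(2) unfolding open_dense_def by blast
    define b2 where "b2 = max b1 a2"
    define x2 where "x2 = splice b1 x1 y2"
    \<comment> \<open>Generic points, which still agree above a, show which values of the code can be decided.\<close>
    obtain x3 y3 where 3: "x3 \<in> A" "y3 \<in> A" "agree b2 x2 x3" "agree b2 y2 y3"
        "\<And>k. \<not> k < b2 \<Longrightarrow> x3 k = y3 k"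
      using generic_pair[OF A, of b2 x2 y2] by blast
    have le: "a \<le> b1" "b1 \<le> b2" "a1 \<le> b1" "a2 \<le> b2" unfolding b1_def b2_def by simp_all
    have x31: "agree b1 x1 x3"
      unfolding agree_def
    proof (intro allI impI)
      fix k assume k: "k < b1"
      then have "k < b2" using le by simp
      then have "x3 k = x2 k" using 3(3) unfolding agree_def by simp
      then show "x1 k = x3 k" using k unfolding x2_def splice_def by simp
    qed
    have x3: "agree a (X z) x3"
      using agree_trans[OF x1(1) agree_mono[OF x31 le(1)]] .
    have y3: "agree a (Y z) y3"
      unfolding agree_def
    proof (intro allI impI)
      fix k assume k: "k < a"
      then have "k < b1" "k < b2" using le by simp_all
      then have "y3 k = y2 k" "y2 k = y1 k" using 3(4) y2(1) unfolding agree_def by simp_all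
      then show "Y z k = y3 k" using k unfolding y1_def splice_def by simp
    qed
    have same: "x3 k = y3 k" if k: "\<not> k < a" for k
    proof (cases "k < b2")
      case True
      then have e: "x3 k = x2 k" "y3 k = y2 k" using 3(3,4) unfolding agree_def by simp_all
      show ?thesis
      proof (cases "k < b1")
        case True
        then have "y2 k = y1 k" using y2(1) unfolding agree_def by simp
        then show ?thesis using e True k unfolding x2_def y1_def splice_def by simp
      qed (use e in \<open>simp add: x2_def splice_def\<close>)
    qed (use 3(5) in simp)
    let ?b = "code x3 y3"
    have "\<forall>k. \<exists>c. \<forall>x'\<in>A. \<forall>y'\<in>A. agree c x3 x' \<and> agree c y3 y' \<longrightarrow> code x' y' k = ?b k"
      using continuous[OF 3(1,2)] by blast
    then have "\<exists>c. \<forall>k. \<forall>x'\<in>A. \<forall>y'\<in>A. agree (c k) x3 x' \<and> agree (c k) y3 y' \<longrightarrow> code x' y' k = ?b k"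
      by (rule choice)
    then obtain c where c: "\<And>k x' y'. x' \<in> A \<Longrightarrow> y' \<in> A \<Longrightarrow> agree (c k) x3 x' \<Longrightarrow> agree (c k) y3 y' \<Longrightarrow>
        code x' y' k = ?b k" by blast
    \<comment> \<open>By regularity a condition of length less than \<kappa> decides the code up to i.\<close>
    obtain b' where b': "\<forall>k<i. c k < b'" using bounded_initial by blast
    define b3 where "b3 = max b2 b'"
    have decided: "agree i (code x' y') ?b" if "x' \<in> A" "y' \<in> A" "agree b3 x3 x'" "agree b3 y3 y'" for x' y'
      unfolding agree_def
    proof (intro allI impI)
      fix k assume "k < i"
      then have "c k \<le> b3" using b' unfolding b3_def by (simp add: less_imp_le max.coboundedI2)
      then show "code x' y' k = ?b k" using c[of x' y' k] that agree_mono by blast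
    qed
    obtain c' where c': "\<forall>j. q j < b3 \<longrightarrow> j < c'" using inj_preimage_bounded[OF q] by blast
    \<comment> \<open>Add one new difference, at a node of length i of the decided branch whose position is not yet used.\<close>
    obtain j where j: "node_length j = i" "on_branch j ?b" "max i c' \<le> j" using exists_node by blast
    have qj: "\<not> q j < b3" using c' j(3) by (metis max.bounded_iff not_le)
    define y4 where "y4 = y3(q j := \<not> x3 (q j))"
    obtain b4 where b4: "max (q j) i < b4" using no_greatest by blast
    define z' where "z' = (\<lambda>k. (x3 k, y4 k))"
    have z': "X z' = x3" "Y z' = y4" unfolding X_def Y_def z'_def by simp_all
    have "q j < b4" "i < b4" using b4 by simp_all
    moreover from this have "b3 \<le> b4" using qj by simp
    moreover have "b2 \<le> b3" unfolding b3_def by simp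
    ultimately have le4: "b3 \<le> b4" "q j < b4" "i < b4" "b2 \<le> b3" by blast+
    have y34: "agree b3 y3 y4" using qj unfolding y4_def agree_def by auto
    have ab: "a \<le> b3" using le le4 by simp
    have y4: "agree a (Y z) y4" using agree_trans[OF y3 agree_mono[OF y34 ab]] .
    have a0: "a0 \<le> a" "agree a0 x0 (X z)" "agree a0 x0 (Y z)" using L unfolding L_def by blast+
    have "agree a0 x0 x3" "agree a0 x0 y4"
      using agree_trans[OF a0(2) agree_mono[OF x3 a0(1)]] agree_trans[OF a0(3) agree_mono[OF y4 a0(1)]] .
    moreover have "x3 k = y4 k" if k: "k \<notin> range q" for k
    proof -
      have "y4 k = y3 k" using k unfolding y4_def by auto
      moreover have "x3 k = y3 k"
      proof (cases "k < a")
        case True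
        then show ?thesis using L k x3 y3 unfolding L_def agree_def by simp
      qed (rule same)
      ultimately show ?thesis by simp
    qed
    moreover have "forced j' b4 x3 y4" if j': "q j' < b4" "x3 (q j') \<noteq> y4 (q j')" for j'
    proof (cases "j' = j")
      case True
      show ?thesis unfolding forced_def True
      proof (intro ballI impI)
        fix x' y' assume "x' \<in> A" "y' \<in> A" "agree b4 x3 x' \<and> agree b4 y4 y'"
        then have "agree i (code x' y') ?b"
          using decided[of x' y'] agree_mono le4(1) agree_trans[OF y34] by blast
        then show "on_branch j (code x' y')"
          using j(1,2) unfolding on_branch_def by (metis agree_sym agree_trans)
      qed
    next
      case False
      then have "q j' \<noteq> q j" using q by (auto dest: injD)
      then have "x3 (q j') \<noteq> y3 (q j')" using j'(2) unfolding y4_def by simp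
      then have less: "q j' < a" using same by blast
      then have "X z (q j') \<noteq> Y z (q j')"
        using \<open>x3 (q j') \<noteq> y3 (q j')\<close> x3 y3 unfolding agree_def by simp
      then have "forced j' a (X z) (Y z)" using L less unfolding L_def by blast
      then show ?thesis by (rule forced_mono) (use ab le4 x3 y4 in simp_all)
    qed
    moreover have "a0 \<le> b4" using a0(1) ab le4(1) by simp
    ultimately have "L b4 z'" unfolding L_def z' by simp
    moreover have "G i b4 z'"
    proof -
      have "w \<in> D i" if "agree b4 x3 w" for w
      proof -
        have "agree a1 x1 w"
          using agree_trans[OF agree_mono[OF x31 le(3)] agree_mono[OF that, of a1]] le le4 by simp
        then show ?thesis using a1 by blast
      qed
      moreover have "w \<in> D i" if "agree b4 y4 w" for w
      proof -
        have "agree a2 y3 w"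
          using agree_trans[OF agree_mono[OF y34, of a2] agree_mono[OF that, of a2]] le le4 by simp
        then have "agree a2 y2 w" using agree_trans[OF agree_mono[OF 3(4) le(4)]] by blast
        then show ?thesis using a2 by blast
      qed
      moreover have "x3 (q j) \<noteq> y4 (q j)" unfolding y4_def by simp
      ultimately show ?thesis unfolding G_def z' using le4 j by auto
    qed
    moreover have "agree a z z'"
      using x3 y4 unfolding agree_def X_def Y_def z'_def by (simp add: prod_eq_iff)
    moreover have "a \<le> b4" using ab le4 by simp
    ultimately show "\<exists>b y. a \<le> b \<and> agree a z y \<and> L b y \<and> G i b y" by blast
  next
    show "L a0 (\<lambda>i. (x0 i, x0 i))" unfolding L_def X_def Y_def by simp
  qed
  then obtain z where z: "agree a0 (\<lambda>i. (x0 i, x0 i)) z" "\<And>i. \<exists>a. L a z \<and> G i a z" by blast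
  let ?x = "X z" and ?y = "Y z"
  have "?x \<in> D i" "?y \<in> D i" for i
    using z(2)[of i] agree_refl unfolding G_def by blast+
  then have mem: "?x \<in> A" "?y \<in> A" using D(2) by blast+
  have start: "agree a0 x0 ?x" "agree a0 x0 ?y" using z(2)[of a0] unfolding L_def by blast+
  have off: "?x i = ?y i" if "i \<notin> range q" for i
    using z(2)[of i] that unfolding L_def G_def by blast
  have "on_branch j (code ?x ?y)" if j: "?x (q j) \<noteq> ?y (q j)" for j
  proof -
    obtain a where "L a z" "q j < a" using z(2)[of "q j"] unfolding G_def by blast
    then have "forced j a ?x ?y" using j unfolding L_def by blast
    then show ?thesis using mem agree_refl unfolding forced_def by blast
  qed
  note on = this
  have "along (\<lambda>j. ?x (q j) \<noteq> ?y (q j)) (code ?x ?y)"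
    unfolding along_def
  proof
    fix i
    obtain j where "?x (q j) \<noteq> ?y (q j)" "i \<le> j" "i \<le> node_length j"
      using z(2)[of i] unfolding G_def by blast
    then show "\<exists>j. ?x (q j) \<noteq> ?y (q j) \<and> i \<le> j \<and> i \<le> node_length j \<and> on_branch j (code ?x ?y)"
      using on by blast
  qed
  then show ?thesis using mem start off on by (intro bexI[of _ ?x] bexI[of _ ?y]) simp_all
qed

end

section \<open>Stationary differences prevent reductions\<close>

context kappa begin

text \<open>
  The positions of the diagonal part of the slice \<open>d\<close>, on which \<open>Q\<^sub>d\<close> is equality modulo the ideal.
\<close>

definition fresh :: "'k \<Rightarrow> 'k \<Rightarrow> 'k" where
  "fresh d j = pos (d, pos (d, j))"

lemma inj_fresh: "inj (fresh (d :: 'k))"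
  by (auto intro!: injI simp: fresh_def)

lemma fresh_at: "slice (slice u d) d j = u (fresh d j)"
  by (simp add: slice_def fresh_def)

lemma slice_eq_off_fresh:
  assumes "\<And>i. i \<notin> range (fresh d) \<Longrightarrow> x i = y i"
  shows "e \<noteq> d \<Longrightarrow> slice x e = slice (y :: 'k \<Rightarrow> bool) e"
    and "e \<noteq> d \<Longrightarrow> slice (slice x d) e = slice (slice y d) e"
  using assms by (auto simp: slice_def fresh_def fun_eq_iff image_iff)

lemma tower_differ_fresh:
  assumes d: "d \<noteq> ord0" and eq: "\<And>e. e < d \<Longrightarrow> slice u e = slice v e"
  shows "(u, v) \<in> tower d \<longleftrightarrow> (\<lambda>j. slice u d j \<noteq> slice v d j) \<in> branch_ideal (failure tower (d :: 'k))"
  using eq by (simp add: tower_above[OF d] tower_refl ideal_rel_def)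

lemma embedded_rel_differ_fresh:
  assumes d: "d \<noteq> (ord0 :: 'k)" and eq: "\<And>i. i \<notin> range (fresh d) \<Longrightarrow> x i = y i"
  shows "(x, y) \<in> embedded_rel Y \<longleftrightarrow> (\<lambda>j. x (fresh d j) \<noteq> y (fresh d j)) \<in> branch_ideal (failure tower d)"
proof -
  have col: "e \<noteq> d \<Longrightarrow> slice x e = slice y e"
      "e \<noteq> d \<Longrightarrow> slice (slice x d) e = slice (slice y d) e" for e
    using slice_eq_off_fresh[of d x y e] eq by blast+
  have "(x, y) \<in> tail_rel (\<lambda>\<beta>. \<beta> \<in> Y)"
    unfolding tail_rel_def mem_Collect_eq case_prod_conv
  proof (intro allI impI)
    fix \<beta> assume \<beta>: "cofinality_omega \<beta> \<and> \<beta> \<in> Y"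
    show "\<exists>\<alpha><\<beta>. \<forall>e. \<alpha> \<le> e \<and> e < \<beta> \<longrightarrow> slice x e = slice y e"
    proof (cases "d < \<beta>")
      case True
      then obtain \<alpha> where "d < \<alpha>" "\<alpha> < \<beta>" using cofinality_omega_limit \<beta> by blast
      then show ?thesis using col(1) by (intro exI[of _ \<alpha>]) auto
    next
      case False
      then show ?thesis using col(1) cofinality_omega_pos \<beta> by (intro exI[of _ ord0]) auto
    qed
  qed
  moreover have "(slice x e, slice y e) \<in> tower e" if "e \<noteq> d" for e
    using col(1)[OF that] by (simp add: tower_refl)
  then have "(\<forall>e. (slice x e, slice y e) \<in> tower e) \<longleftrightarrow> (slice x d, slice y d) \<in> tower d"
    by metis
  ultimately have "(x, y) \<in> embedded_rel Y \<longleftrightarrow> (slice x d, slice y d) \<in> tower d"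
    unfolding embedded_rel_def by blast
  also have "\<dots> \<longleftrightarrow> (\<lambda>j. x (fresh d j) \<noteq> y (fresh d j)) \<in> branch_ideal (failure tower d)"
    using col(2) by (subst tower_differ_fresh[OF d]) (auto simp: fresh_at)
  finally show ?thesis .
qed

context
  fixes X Y :: "'k set" and f :: "('k \<Rightarrow> bool) \<Rightarrow> 'k \<Rightarrow> bool" and A :: "('k \<Rightarrow> bool) set"
  assumes reduces: "\<And>x y. (x, y) \<in> embedded_rel Y \<longleftrightarrow> (f x, f y) \<in> embedded_rel X"
    and A: "comeager A" and f: "continuous_in A f"
begin

text \<open>
  A reduction cannot confine the effect of changes in the slice \<open>d\<close> to slices of the image with index
  below \<open>d\<close>. For otherwise take a pair whose difference codes its own images and \<open>X\<close>. The points are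
  \<open>E\<^sub>Y\<close>-equivalent if and only if the code is in \<open>failure tower d\<close>, that is, if the images are not
  \<open>E\<^sub>X\<close>-equivalent.
\<close>

lemma image_slices_differ:
  assumes d: "d \<noteq> (ord0 :: 'k)"
  shows "\<exists>x\<in>A. \<exists>y\<in>A. agree a x0 x \<and> agree a x0 y \<and> (\<forall>i. i \<notin> range (fresh d) \<longrightarrow> x i = y i) \<and>
    (\<exists>i. d \<le> fst (inv pos i) \<and> f x i \<noteq> f y i)"
proof -
  define code where "code = (\<lambda>x y i. case inv pos i of (e, k) \<Rightarrow>
    if e = ord0 then f x k else if e = ord1 then f y k else k \<in> X)"
  have code: "slice (code x y) ord0 = f x" "slice (code x y) ord1 = f y"
      "slice (code x y) ord2 = (\<lambda>k. k \<in> X)" for x y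
    by (simp_all add: code_def slice_def fun_eq_iff)
  have continuous: "\<exists>a. \<forall>x'\<in>A. \<forall>y'\<in>A. agree a x x' \<and> agree a y y' \<longrightarrow> code x' y' i = code x y i"
    if x: "x \<in> A" and y: "y \<in> A" for x y i
  proof -
    obtain e k where i: "inv pos i = (e, k)" by (meson surj_pair)
    obtain a where a: "\<forall>x'\<in>A. agree a x x' \<longrightarrow> f x' k = f x k"
      using f x unfolding continuous_in_def by blast
    obtain b where b: "\<forall>y'\<in>A. agree b y y' \<longrightarrow> f y' k = f y k"
      using f y unfolding continuous_in_def by blast
    have "code x' y' i = code x y i"
      if "x' \<in> A" "y' \<in> A" "agree (max a b) x x'" "agree (max a b) y y'" for x' y'
    proof -
      have "f x' k = f x k" using a that(1) agree_mono[OF that(3), of a] by simp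
      moreover have "f y' k = f y k" using b that(2) agree_mono[OF that(4), of b] by simp
      ultimately show ?thesis unfolding code_def i by simp
    qed
    then show ?thesis by blast
  qed
  have "\<exists>x\<in>A. \<exists>y\<in>A. agree a x0 x \<and> agree a x0 y \<and>
      (\<forall>i. i \<notin> range (fresh d) \<longrightarrow> x i = y i) \<and>
      (\<forall>j. x (fresh d j) \<noteq> y (fresh d j) \<longrightarrow> on_branch j (code x y)) \<and>
      along (\<lambda>j. x (fresh d j) \<noteq> y (fresh d j)) (code x y)"
  proof (rule diagonal_pair[OF A inj_fresh])
    show "\<exists>a. \<forall>x'\<in>A. \<forall>y'\<in>A. agree a x x' \<and> agree a y y' \<longrightarrow> code x' y' i = code x y i"
      if "x \<in> A" "y \<in> A" for x y i
      using continuous that by blast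
  qed
  then obtain x y where xy: "x \<in> A" "y \<in> A" "agree a x0 x" "agree a x0 y"
    and off: "\<And>i. i \<notin> range (fresh d) \<Longrightarrow> x i = y i"
    and on: "\<And>j. x (fresh d j) \<noteq> y (fresh d j) \<Longrightarrow> on_branch j (code x y)"
    and along: "along (\<lambda>j. x (fresh d j) \<noteq> y (fresh d j)) (code x y)"
    by blast
  have "\<exists>i. d \<le> fst (inv pos i) \<and> f x i \<noteq> f y i"
  proof (rule ccontr)
    assume not: "\<not> ?thesis"
    have same: "slice (f x) e = slice (f y) e" if "\<not> e < d" for e
    proof
      fix k
      have "d \<le> fst (inv pos (pos (e, k)))" using that by simp
      then show "slice (f x) e k = slice (f y) e k" using not unfolding slice_def by blast
    qed
    have "(x, y) \<in> embedded_rel Y \<longleftrightarrow>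
        (\<lambda>j. x (fresh d j) \<noteq> y (fresh d j)) \<in> branch_ideal (failure tower d)"
      by (rule embedded_rel_differ_fresh[OF d]) (rule off)
    also have "\<dots> \<longleftrightarrow> code x y \<in> failure tower d"
      by (rule branch_ideal_coding) (erule on, rule along)
    also have "\<dots> \<longleftrightarrow> \<not> ((\<forall>e<d. (slice (f x) e, slice (f y) e) \<in> tower e) \<and>
        (f x, f y) \<in> tail_rel (\<lambda>k. k \<in> X))"
      by (simp only: failure_def mem_Collect_eq code)
    also have "\<dots> \<longleftrightarrow> (f x, f y) \<notin> embedded_rel X"
    proof -
      have "(slice (f x) e, slice (f y) e) \<in> tower e" if "\<not> e < d" for e
        using same[OF that] by (simp add: tower_refl)
      then show ?thesis unfolding embedded_rel_def by blast
    qed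
    finally show False using reduces by blast
  qed
  then show ?thesis using xy off by blast
qed

text \<open>
  The conditions of lengths \<open>a\<close> on \<open>x\<close> and \<open>y\<close> may already differ, whereas \<open>image_slices_differ\<close> starts
  from a single condition. It gives two extensions of the condition on \<open>x\<close> with different
  images; a suitable extension of the condition on \<open>y\<close> has an image that differs from one of them.
\<close>

lemma game_step:
  assumes \<gamma>: "\<gamma> \<noteq> (ord0 :: 'k)"
  shows "\<exists>a' x' y'. a \<le> a' \<and> agree a x x' \<and> agree a y y' \<and>
    (\<forall>i. a \<le> i \<and> i < a' \<and> i \<notin> range (fresh \<gamma>) \<longrightarrow> x' i = y' i) \<and>
    (\<exists>i. \<gamma> \<le> fst (inv pos i) \<and> fst (inv pos i) < a' \<and>
      (\<forall>u\<in>A. \<forall>v\<in>A. agree a' x' u \<and> agree a' y' v \<longrightarrow> f u i \<noteq> f v i))"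
proof -
  obtain u v i where uv: "u \<in> A" "v \<in> A" "agree a x u" "agree a x v"
      "\<And>k. k \<notin> range (fresh \<gamma>) \<Longrightarrow> u k = v k" and i: "\<gamma> \<le> fst (inv pos i)" "f u i \<noteq> f v i"
    using image_slices_differ[OF \<gamma>, of a x] by blast
  obtain c where c: "\<forall>w\<in>A. agree c u w \<longrightarrow> f w i = f u i"
    using f uv(1) unfolding continuous_in_def by blast
  obtain d where d: "\<forall>w\<in>A. agree d v w \<longrightarrow> f w i = f v i"
    using f uv(2) unfolding continuous_in_def by blast
  define b where "b = max a (max c d)"
  obtain y1 where y1: "y1 \<in> A" "agree b (splice a y u) y1" using baire[OF A] by blast
  obtain e where e: "\<forall>w\<in>A. agree e y1 w \<longrightarrow> f w i = f y1 i"
    using f y1(1) unfolding continuous_in_def by blast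
  obtain i' where i': "fst (inv pos i) < i'" using no_greatest by blast
  define a' where "a' = max b (max e i')"
  have le: "a \<le> b" "c \<le> b" "d \<le> b" "b \<le> a'" "e \<le> a'" "i' \<le> a'"
    unfolding a'_def b_def by (auto simp: le_max_iff_disj)
  \<comment> \<open>Bits have only two values, so the value at y1 differs from the value at u or at v.\<close>
  obtain w where w: "w = u \<or> w = v" "f w i \<noteq> f y1 i" using i(2) by blast
  have w_u: "w k = u k" if "k \<notin> range (fresh \<gamma>)" for k using w(1) uv(5)[OF that] by auto
  have y1_u: "y1 k = u k" if "k < b" "\<not> k < a" for k
  proof -
    have "splice a y u k = y1 k" using y1(2) that(1) unfolding agree_def by blast
    then show ?thesis using that(2) unfolding splice_def by simp
  qed
  define x' where "x' = splice b w y1"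
  have "agree a x x'"
    unfolding agree_def x'_def splice_def
    using w(1) uv(3,4) le(1) by (auto simp: agree_def)
  moreover have "agree a y y1"
    using agree_trans[OF agree_splice(2) agree_mono[OF y1(2) le(1)]] .
  moreover have "x' k = y1 k" if "a \<le> k" "k \<notin> range (fresh \<gamma>)" for k
    using w_u[OF that(2)] y1_u[of k] that(1) unfolding x'_def splice_def by auto
  moreover have "f p i \<noteq> f q i" if "p \<in> A" "q \<in> A" "agree a' x' p" "agree a' y1 q" for p q
  proof -
    have "f q i = f y1 i" using e that(2) agree_mono[OF that(4) le(5)] by blast
    moreover have "agree b w p"
      using agree_trans[OF agree_splice(2) agree_mono[OF that(3) le(4), unfolded x'_def]] .
    then have "f p i = f w i"
      using w(1) c d that(1) agree_mono[of b w p] le(2,3) by blast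
    ultimately show ?thesis using w(2) by simp
  qed
  moreover have "fst (inv pos i) < a'" using i' le(6) by simp
  moreover have "a \<le> a'" using le(1,4) by simp
  ultimately show ?thesis using i(1)
    by (intro exI[of _ a'] exI[of _ x'] exI[of _ y1] conjI exI[of _ i]) auto
qed

end

lemma bounded_on_lists:
  "\<exists>c. \<forall>\<sigma>. length \<sigma> = n \<and> set \<sigma> \<subseteq> {..<b} \<longrightarrow> g \<sigma> < (c :: 'k)" for g :: "'k list \<Rightarrow> 'k"
proof (induction n arbitrary: g)
  case 0
  then show ?case using no_greatest[of "g []"] by simp
next
  case (Suc n)
  have "\<forall>\<gamma>. \<exists>c. \<forall>\<sigma>. length \<sigma> = n \<and> set \<sigma> \<subseteq> {..<b} \<longrightarrow> g (\<gamma> # \<sigma>) < c"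
    by (intro allI Suc)
  then have "\<exists>c. \<forall>\<gamma>. \<forall>\<sigma>. length \<sigma> = n \<and> set \<sigma> \<subseteq> {..<b} \<longrightarrow> g (\<gamma> # \<sigma>) < c \<gamma>"
    by (rule choice)
  then obtain c where c: "\<And>\<gamma> \<sigma>. length \<sigma> = n \<Longrightarrow> set \<sigma> \<subseteq> {..<b} \<Longrightarrow> g (\<gamma> # \<sigma>) < c \<gamma>" by blast
  obtain c' where c': "\<forall>\<gamma><b. c \<gamma> < c'" using bounded_initial by blast
  have "g \<sigma> < c'" if \<sigma>: "length \<sigma> = Suc n" "set \<sigma> \<subseteq> {..<b}" for \<sigma>
  proof -
    obtain \<gamma> \<tau> where "\<sigma> = \<gamma> # \<tau>" using \<sigma>(1) by (cases \<sigma>) auto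
    then show ?thesis using c[of \<tau> \<gamma>] c' \<sigma> by (auto intro: order_less_trans)
  qed
  then show ?case by blast
qed

text \<open>
  Finite sequences suffice because a play of length \<open>\<omega>\<close> is determined by its finite initial segments.
  There can be \<open>\<kappa>\<close> many conditions of a given length, so one cannot close under all of them, but only
  under those that occur in plays.
\<close>

definition closure_points :: "('k list \<Rightarrow> 'k) \<Rightarrow> 'k set" where
  "closure_points g = {\<beta>. cofinality_omega \<beta> \<and> (\<forall>\<sigma>. set \<sigma> \<subseteq> {..<\<beta>} \<longrightarrow> g \<sigma> < \<beta>)}"

lemma finite_below_sequence:
  assumes \<alpha>: "strict_mono (\<alpha> :: nat \<Rightarrow> 'k)" "(LEAST s. \<forall>i. \<alpha> i \<le> s) = \<beta>"
    and "set \<sigma> \<subseteq> {..<\<beta>}"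
  shows "\<exists>n. set \<sigma> \<subseteq> {..<\<alpha> n}"
  using assms(3)
proof (induction \<sigma>)
  case (Cons \<gamma> \<sigma>)
  then obtain n where n: "set \<sigma> \<subseteq> {..<\<alpha> n}" by auto
  obtain m where m: "\<gamma> < \<alpha> m" using cofinal_sequence(2)[OF \<alpha>, of \<gamma>] Cons.prems by auto
  have "\<alpha> n \<le> \<alpha> (max m n)" "\<alpha> m \<le> \<alpha> (max m n)"
    using \<alpha>(1) by (simp_all add: strict_mono_less_eq)
  then show ?case using n m by (intro exI[of _ "max m n"]) (auto dest: subsetD)
qed simp

lemma closure_points_closed: "omega_closed (closure_points g)"
  unfolding omega_closed_def
proof (intro allI impI)
  fix \<alpha> :: "nat \<Rightarrow> 'k"
  assume *: "strict_mono \<alpha> \<and> range \<alpha> \<subseteq> closure_points g"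
  define \<beta> where "\<beta> = (LEAST s. \<forall>i. \<alpha> i \<le> s)"
  have \<alpha>: "strict_mono \<alpha>" "(LEAST s. \<forall>i. \<alpha> i \<le> s) = \<beta>" using * \<beta>_def by simp_all
  have "g \<sigma> < \<beta>" if \<sigma>: "set \<sigma> \<subseteq> {..<\<beta>}" for \<sigma>
  proof -
    obtain n where n: "set \<sigma> \<subseteq> {..<\<alpha> n}" using finite_below_sequence[OF \<alpha> \<sigma>] by blast
    have "\<alpha> n \<in> closure_points g" using * by blast
    then have "g \<sigma> < \<alpha> n" using n unfolding closure_points_def by blast
    then show ?thesis using cofinal_sequence(1)[OF \<alpha>, of n] by simp
  qed
  then show "(LEAST s. \<forall>i. \<alpha> i \<le> s) \<in> closure_points g"
    using \<alpha> unfolding closure_points_def cofinality_omega_def by blast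
qed

text \<open>
  Iterate a bound for the values on lists below a given ordinal \<open>\<omega>\<close> times.
\<close>

lemma closure_points_unbounded: "unbounded (closure_points g)"
  unfolding unbounded_def
proof
  fix a :: 'k
  have "\<exists>c. b < c \<and> (\<forall>\<sigma>. set \<sigma> \<subseteq> {..<b} \<longrightarrow> g \<sigma> < c)" for b :: 'k
  proof -
    have "\<forall>n. \<exists>c. \<forall>\<sigma>. length \<sigma> = n \<and> set \<sigma> \<subseteq> {..<b} \<longrightarrow> g \<sigma> < c"
      using bounded_on_lists by blast
    then have "\<exists>c. \<forall>n. \<forall>\<sigma>. length \<sigma> = n \<and> set \<sigma> \<subseteq> {..<b} \<longrightarrow> g \<sigma> < c n"
      by (rule choice)
    then obtain c where c: "\<And>\<sigma>. set \<sigma> \<subseteq> {..<b} \<Longrightarrow> g \<sigma> < c (length \<sigma>)" by blast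
    obtain c' where c': "\<forall>n. c n < c'" using bounded_sequence by blast
    obtain c'' where c'': "max b c' < c''" using no_greatest by blast
    have "g \<sigma> < c''" if "set \<sigma> \<subseteq> {..<b}" for \<sigma>
    proof -
      have "g \<sigma> < c (length \<sigma>)" by (rule c[OF that])
      also have "\<dots> < c'" using c' by blast
      also have "\<dots> < c''" using c'' by simp
      finally show ?thesis .
    qed
    then show ?thesis using c'' by (intro exI[of _ c'']) simp
  qed
  then have "\<exists>h. \<forall>b. b < h b \<and> (\<forall>\<sigma>. set \<sigma> \<subseteq> {..<b} \<longrightarrow> g \<sigma> < h b)"
    by (intro choice) blast
  then obtain h where h: "\<And>b. b < h b" "\<And>b \<sigma>. set \<sigma> \<subseteq> {..<b} \<Longrightarrow> g \<sigma> < h b" by blast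
  define \<alpha> where "\<alpha> = (\<lambda>n. (h ^^ n) a)"
  have "strict_mono \<alpha>" unfolding strict_mono_Suc_iff \<alpha>_def using h(1) by simp
  define \<beta> where "\<beta> = (LEAST s. \<forall>i. \<alpha> i \<le> s)"
  have \<alpha>: "strict_mono \<alpha>" "(LEAST s. \<forall>i. \<alpha> i \<le> s) = \<beta>" using \<open>strict_mono \<alpha>\<close> \<beta>_def by simp_all
  have "g \<sigma> < \<beta>" if \<sigma>: "set \<sigma> \<subseteq> {..<\<beta>}" for \<sigma>
  proof -
    obtain n where n: "set \<sigma> \<subseteq> {..<\<alpha> n}" using finite_below_sequence[OF \<alpha> \<sigma>] by blast
    have "g \<sigma> < \<alpha> (Suc n)" using h(2)[OF n] unfolding \<alpha>_def by simp
    also have "\<dots> < \<beta>" by (rule cofinal_sequence(1)[OF \<alpha>])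
    finally show ?thesis .
  qed
  then have "\<beta> \<in> closure_points g"
    using \<alpha> unfolding closure_points_def cofinality_omega_def by blast
  moreover have "a < \<beta>" using cofinal_sequence(1)[OF \<alpha>, of 0] unfolding \<alpha>_def by simp
  ultimately show "\<exists>c\<in>closure_points g. a < c" by blast
qed

lemma not_reducible_if_stationary:
  assumes stationary: "omega_stationary (X - Y)"
  shows "\<not> borel_reducible (embedded_rel Y) (embedded_rel (X :: 'k set))"
proof
  assume "borel_reducible (embedded_rel Y) (embedded_rel X)"
  then obtain f :: "('k \<Rightarrow> bool) \<Rightarrow> 'k \<Rightarrow> bool" where "borel_function f"
    and reduces: "\<And>x y. (x, y) \<in> embedded_rel Y \<longleftrightarrow> (f x, f y) \<in> embedded_rel X"
    unfolding borel_reducible_def by blast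
  then obtain A where A: "comeager A" "continuous_in A f"
    using borel_function_continuous by blast
  \<comment> \<open>A move in the game: the opponent chooses the index \<gamma>, the answer is given by the preceding lemma.\<close>
  define good where "good = (\<lambda>\<gamma> (a, x, y) (a', x', y'). a \<le> a' \<and> agree a x x' \<and> agree a y y' \<and>
    (\<forall>i. a \<le> i \<and> i < a' \<and> i \<notin> range (fresh \<gamma>) \<longrightarrow> x' i = (y' i :: bool)) \<and>
    (\<exists>i. \<gamma> \<le> fst (inv pos i) \<and> fst (inv pos i) < a' \<and>
      (\<forall>u\<in>A. \<forall>v\<in>A. agree a' x' u \<and> agree a' y' v \<longrightarrow> f u i \<noteq> f v i)))"
  define step where "step = (\<lambda>\<gamma> s. SOME s'. good \<gamma> s s')"
  have step: "good \<gamma> s (step \<gamma> s)" if "\<gamma> \<noteq> ord0" for \<gamma> s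
  proof -
    obtain a x y where s: "s = (a, x, y)" by (metis prod_cases3)
    have "\<exists>s'. good \<gamma> s s'"
      using game_step[OF reduces A that, of a x y] unfolding good_def s by auto
    then show ?thesis unfolding step_def by (rule someI_ex)
  qed
  define play where "play = (\<lambda>\<sigma>. foldr step \<sigma> (ord0, (\<lambda>_. False), (\<lambda>_. False)))"
  obtain \<beta> where \<beta>: "\<beta> \<in> X" "\<beta> \<notin> Y" "\<beta> \<in> closure_points (\<lambda>\<sigma>. fst (play \<sigma>))"
    using stationary closure_points_closed closure_points_unbounded
    unfolding omega_stationary_def by blast
  then have cof: "cofinality_omega \<beta>"
    and closed: "\<And>\<sigma>. set \<sigma> \<subseteq> {..<\<beta>} \<Longrightarrow> fst (play \<sigma>) < \<beta>"
    unfolding closure_points_def by blast+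
  obtain \<alpha> :: "nat \<Rightarrow> 'k" where \<alpha>: "strict_mono \<alpha>" "(LEAST s. \<forall>i. \<alpha> i \<le> s) = \<beta>"
    using cof unfolding cofinality_omega_def by blast
  \<comment> \<open>The shift makes the indices nonzero.\<close>
  define \<gamma> where "\<gamma> = (\<lambda>n. \<alpha> (Suc n))"
  have \<gamma>_mono: "strict_mono \<gamma>" using \<alpha>(1) unfolding \<gamma>_def strict_mono_def by simp
  have \<gamma>_less: "\<gamma> n < \<beta>" for n unfolding \<gamma>_def by (rule cofinal_sequence(1)[OF \<alpha>])
  have \<gamma>_cofinal: "\<exists>n. \<delta> < \<gamma> n" if \<delta>: "\<delta> < \<beta>" for \<delta>
  proof -
    obtain n where "\<delta> < \<alpha> n" using cofinal_sequence(2)[OF \<alpha> \<delta>] by blast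
    also have "\<alpha> n < \<gamma> n" using \<alpha>(1) unfolding \<gamma>_def strict_mono_def by simp
    finally show ?thesis by blast
  qed
  have \<gamma>_nonzero: "\<gamma> n \<noteq> ord0" for n
  proof -
    have "\<alpha> n < \<gamma> n" using \<alpha>(1) unfolding \<gamma>_def strict_mono_def by simp
    then show ?thesis by (metis not_less_ord0)
  qed
  define s where "s = (\<lambda>n. play (rev (map \<gamma> [0..<n])))"
  have s_Suc: "s (Suc n) = step (\<gamma> n) (s n)" for n
    unfolding s_def play_def by simp
  define a where "a = (\<lambda>n. fst (s n))"
  define x where "x = (\<lambda>n. fst (snd (s n)))"
  define y where "y = (\<lambda>n. snd (snd (s n)))"
  have s_eq: "s n = (a n, x n, y n)" for n unfolding a_def x_def y_def by simp
  have good: "good (\<gamma> n) (a n, x n, y n) (a (Suc n), x (Suc n), y (Suc n))" for n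
    using step[OF \<gamma>_nonzero, of n "s n"] s_Suc[of n] s_eq by simp
  have a_less: "a n < \<beta>" for n
    unfolding a_def s_def using \<gamma>_less by (intro closed) auto
  have a0: "a 0 = ord0" unfolding a_def s_def play_def by simp
  have a_mono: "a m \<le> a n" if "m \<le> n" for m n
    using that by (rule lift_Suc_mono_le[rotated]) (use good in \<open>simp add: good_def\<close>)
  have coherent: "agree (a m) (x m) (x n) \<and> agree (a m) (y m) (y n)" if "m \<le> n" for m n
    using that
  proof (induction n rule: dec_induct)
    case (step n)
    have "agree (a n) (x n) (x (Suc n))" "agree (a n) (y n) (y (Suc n))"
      using good[of n] unfolding good_def by simp_all
    then show ?case using step a_mono[OF step(1)] agree_trans agree_mono by blast
  qed simp
  \<comment> \<open>The union of a chain of conditions; it is constant, and hence without differences, above their lengths.\<close>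
  define lim where "lim = (\<lambda>(z :: nat \<Rightarrow> 'k \<Rightarrow> bool) i. if \<exists>n. i < a n then z (LEAST n. i < a n) i else False)"
  have lim: "agree (a n) (z n) (lim z)" if z: "\<And>m n. m \<le> n \<Longrightarrow> agree (a m) (z m) (z n)" for z n
    unfolding agree_def
  proof (intro allI impI)
    fix i assume i: "i < a n"
    let ?m = "LEAST n. i < a n"
    have "i < a ?m" "?m \<le> n" using i by (auto intro: LeastI Least_le)
    then have "z ?m i = z n i" using z[of ?m n] unfolding agree_def by blast
    then show "z n i = lim z i" using i unfolding lim_def by auto
  qed
  obtain u v where uv: "u \<in> A" "v \<in> A" "agree \<beta> (lim x) u" "agree \<beta> (lim y) v"
      "\<And>k. \<not> k < \<beta> \<Longrightarrow> u k = v k"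
    using generic_pair[OF A(1), of \<beta> "lim x" "lim y"] by blast
  have u: "agree (a n) (x n) u" for n
    using agree_trans[OF lim agree_mono[OF uv(3)]] coherent a_less by (simp add: less_imp_le)
  have v: "agree (a n) (y n) v" for n
    using agree_trans[OF lim agree_mono[OF uv(4)]] coherent a_less by (simp add: less_imp_le)
  \<comment> \<open>Every difference below \<beta> was created by a move, in the diagonal part of the slice chosen there.\<close>
  have differ: "\<exists>n. i \<in> range (fresh (\<gamma> n)) \<and> i < \<beta>" if i: "u i \<noteq> v i" for i
  proof -
    have "i < \<beta>" using i uv(5) by blast
    then have "lim x i \<noteq> lim y i" using i uv(3,4) unfolding agree_def by simp
    then have ex: "\<exists>n. i < a n" unfolding lim_def by (auto split: if_splits)
    define m where "m = (LEAST n. i < a n)"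
    have m: "i < a m" using ex unfolding m_def by (rule LeastI_ex)
    then obtain n where n: "m = Suc n" using a0 by (cases m) auto
    have "\<not> i < a n" using not_less_Least[of n "\<lambda>n. i < a n"] n unfolding m_def by simp
    moreover have "x m i \<noteq> y m i" using i u[of m] v[of m] m unfolding agree_def by simp
    moreover have "x (Suc n) k = y (Suc n) k"
      if "\<not> k < a n" "k < a (Suc n)" "k \<notin> range (fresh (\<gamma> n))" for k
      using good[of n] that unfolding good_def by simp
    ultimately have "i \<in> range (fresh (\<gamma> n))"
      using m n by blast
    then show ?thesis using \<open>i < \<beta>\<close> by blast
  qed
  have col: "slice u e = slice v e" if "\<And>n. e \<noteq> \<gamma> n" for e
  proof
    fix k
    show "slice u e k = slice v e k"
    proof (rule ccontr)
      assume "slice u e k \<noteq> slice v e k"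
      then obtain n where "pos (e, k) \<in> range (fresh (\<gamma> n))"
        using differ unfolding slice_def by blast
      then show False using that by (auto simp: fresh_def)
    qed
  qed
  have "(u, v) \<in> embedded_rel Y"
    unfolding embedded_rel_def tail_rel_def mem_Collect_eq case_prod_conv
  proof (intro conjI allI impI)
    fix e
    show "(slice u e, slice v e) \<in> tower e"
    proof (cases "\<exists>n. e = \<gamma> n")
      case True
      then obtain n where e: "e = \<gamma> n" by blast
      have "e \<noteq> ord0" using \<gamma>_nonzero e by simp
      moreover have "slice (slice u e) e' = slice (slice v e) e'" if "e' < e" for e'
      proof
        fix k
        show "slice (slice u e) e' k = slice (slice v e) e' k"
        proof (rule ccontr)
          assume "slice (slice u e) e' k \<noteq> slice (slice v e) e' k"
          then obtain m where "pos (e, pos (e', k)) \<in> range (fresh (\<gamma> m))"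
            using differ unfolding slice_def by blast
          then show False using that by (auto simp: fresh_def)
        qed
      qed
      moreover obtain c where "\<forall>j. fresh e j < \<beta> \<longrightarrow> j < c"
        using inj_preimage_bounded[OF inj_fresh] by blast
      then have "j < c" if "slice (slice u e) e j \<noteq> slice (slice v e) e j" for j
        using differ that unfolding fresh_at by blast
      then have "(\<lambda>j. slice (slice u e) e j \<noteq> slice (slice v e) e j) \<in> branch_ideal (failure tower e)"
        by (rule branch_ideal_bounded)
      ultimately show ?thesis by (subst tower_differ_fresh)
    next
      case False
      then show ?thesis using col by (simp add: tower_refl)
    qed
  next
    fix \<beta>' assume \<beta>': "cofinality_omega \<beta>' \<and> \<beta>' \<in> Y"
    then have "\<beta>' \<noteq> \<beta>" using \<beta>(2) by blast
    then consider "\<beta> < \<beta>'" | "\<beta>' < \<beta>" by fastforce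
    then show "\<exists>\<alpha><\<beta>'. \<forall>d. \<alpha> \<le> d \<and> d < \<beta>' \<longrightarrow> slice u d = slice v d"
    proof cases
      case 1
      have "slice u d = slice v d" if "\<beta> \<le> d" for d
        using \<gamma>_less that by (intro col) (auto simp: not_le[symmetric])
      then show ?thesis using 1 by blast
    next
      case 2
      \<comment> \<open>Only finitely many of the indices are below \<beta>', so they are bounded below \<beta>'.\<close>
      define N where "N = (LEAST n. \<beta>' \<le> \<gamma> n)"
      have "\<exists>n. \<beta>' \<le> \<gamma> n" using \<gamma>_cofinal[OF 2] less_imp_le by blast
      then have N: "\<beta>' \<le> \<gamma> N" unfolding N_def by (rule LeastI_ex)
      have below: "\<gamma> n < \<beta>' \<longleftrightarrow> n < N" for n
      proof
        show "n < N" if "\<gamma> n < \<beta>'"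
          using that N \<gamma>_mono by (metis not_less order_less_le_trans strict_mono_less_eq)
        show "\<gamma> n < \<beta>'" if "n < N"
          using not_less_Least[of n "\<lambda>n. \<beta>' \<le> \<gamma> n"] that unfolding N_def by simp
      qed
      obtain c where c: "c < \<beta>'" "\<And>n. n < N \<Longrightarrow> \<gamma> n < c"
      proof (cases N)
        case 0
        then show ?thesis using that cofinality_omega_pos \<beta>' by blast
      next
        case (Suc M)
        then have "\<gamma> M < \<beta>'" using below by simp
        then obtain c where "\<gamma> M < c" "c < \<beta>'" using cofinality_omega_limit \<beta>' by blast
        moreover have "\<gamma> n \<le> \<gamma> M" if "n < N" for n
          using that Suc \<gamma>_mono by (simp add: strict_mono_less_eq)
        ultimately show ?thesis using that by (meson order_le_less_trans)
      qed
      have "slice u d = slice v d" if d: "c \<le> d" "d < \<beta>'" for d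
      proof (rule col)
        fix n
        show "d \<noteq> \<gamma> n"
        proof
          assume "d = \<gamma> n"
          then have "n < N" using d below by simp
          then show False using c(2)[of n] d \<open>d = \<gamma> n\<close> by simp
        qed
      qed
      then show ?thesis using c(1) by blast
    qed
  qed
  then have "(f u, f v) \<in> tail_rel (\<lambda>k. k \<in> X)"
    using reduces unfolding embedded_rel_def by blast
  then obtain \<delta> where \<delta>: "\<delta> < \<beta>" "\<And>d. \<delta> \<le> d \<Longrightarrow> d < \<beta> \<Longrightarrow> slice (f u) d = slice (f v) d"
    using cof \<beta>(1) unfolding tail_rel_def by blast
  obtain n where n: "\<delta> < \<gamma> n" using \<gamma>_cofinal[OF \<delta>(1)] by blast
  obtain i where i: "\<gamma> n \<le> fst (inv pos i)" "fst (inv pos i) < a (Suc n)" "f u i \<noteq> f v i"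
    using good[of n] u[of "Suc n"] v[of "Suc n"] uv(1,2) unfolding good_def by blast
  have "slice (f u) (fst (inv pos i)) (snd (inv pos i)) \<noteq> slice (f v) (fst (inv pos i)) (snd (inv pos i))"
    using i(3) by (simp add: slice_def)
  moreover have "slice (f u) (fst (inv pos i)) = slice (f v) (fst (inv pos i))"
  proof (rule \<delta>(2))
    show "\<delta> \<le> fst (inv pos i)" using n i(1) by simp
    show "fst (inv pos i) < \<beta>" using i(2) a_less[of "Suc n"] by simp
  qed
  ultimately show False by simp
qed

text \<open>
  Enlarging \<open>Y\<close> shrinks \<open>E\<^sub>Y\<close> and lowers it in the order of Borel reducibility. This is why the embedding
  uses complements.
\<close>

theorem embedded_rel_reducible_iff:
  "borel_reducible (embedded_rel Y) (embedded_rel X) \<longleftrightarrow> \<not> omega_stationary (X - Y :: 'k set)"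
proof
  show "\<not> omega_stationary (X - Y)" if "borel_reducible (embedded_rel Y) (embedded_rel X)"
    using not_reducible_if_stationary that by blast
  assume "\<not> omega_stationary (X - Y)"
  then obtain C where "omega_closed C" "unbounded C" "(X - Y) \<inter> C = {}"
    unfolding omega_stationary_def by blast
  then show "borel_reducible (embedded_rel Y) (embedded_rel X)" by (rule reducible_if_nonstationary)
qed

lemma NS_omega_embeds:
  "quasiorder_embeds (UNIV :: 'k set set) subset_NS_omega
    (borel_equivs :: ('k \<Rightarrow> bool) rel set) borel_reducible"
proof -
  let ?F = "\<lambda>X :: 'k set. embedded_rel (- X)"
  have "subset_NS_omega X Y \<longleftrightarrow> borel_reducible (?F X) (?F Y)" for X Y
  proof -
    have "- Y - - X = X - Y" by auto
    then show ?thesis unfolding embedded_rel_reducible_iff subset_NS_omega_def by simp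
  qed
  moreover have "?F \<in> UNIV \<rightarrow> borel_equivs" using embedded_rel_borel_equiv by simp
  ultimately have "?F \<in> UNIV \<rightarrow> borel_equivs \<and>
      (\<forall>X\<in>UNIV. \<forall>Y\<in>UNIV. subset_NS_omega X Y \<longleftrightarrow> borel_reducible (?F X) (?F Y))"
    by simp
  then show ?thesis unfolding quasiorder_embeds_def Bex_def by (rule exI[where x = ?F])
qed

section \<open>The first uncountable cardinal\<close>

lemma omega_closed_if_ord_closed:
  assumes "ord_closed (C :: 'k set)"
  shows "omega_closed C"
  unfolding omega_closed_def
proof (intro allI impI)
  fix \<alpha> :: "nat \<Rightarrow> 'k" assume \<alpha>: "strict_mono \<alpha> \<and> range \<alpha> \<subseteq> C"
  obtain b where "\<forall>n. \<alpha> n < b" using bounded_sequence by blast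
  then have "bdd_above (range \<alpha>)" by (intro bdd_aboveI[of _ b]) (auto intro: less_imp_le)
  then have "(LEAST s. \<forall>x\<in>range \<alpha>. x \<le> s) \<in> C"
    using assms \<alpha> unfolding ord_closed_def by blast
  then show "(LEAST s. \<forall>i. \<alpha> i \<le> s) \<in> C" by simp
qed

text \<open>
  A supremum that is not attained is the limit of an \<open>\<omega>\<close>-sequence, since it has countable cofinality.
\<close>

lemma ord_closed_if_omega_closed:
  assumes C: "omega_closed (C :: 'k set)" and countable: "\<And>a :: 'k. countable {..<a}"
  shows "ord_closed C"
  unfolding ord_closed_def
proof (intro allI impI)
  fix S assume S: "S \<subseteq> C \<and> S \<noteq> {} \<and> bdd_above S"
  define s where "s = (LEAST s. \<forall>x\<in>S. x \<le> s)"
  have "\<exists>s. \<forall>x\<in>S. x \<le> s" using S unfolding bdd_above_def by blast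
  then have ub: "\<forall>x\<in>S. x \<le> s"
    using LeastI_ex[of "\<lambda>s. \<forall>x\<in>S. x \<le> s"] unfolding s_def by blast
  have least: "\<exists>x\<in>S. \<gamma> < x" if \<gamma>: "\<gamma> < s" for \<gamma>
  proof -
    have "\<not> (\<forall>x\<in>S. x \<le> \<gamma>)"
      using not_less_Least[of \<gamma> "\<lambda>s. \<forall>x\<in>S. x \<le> s"] \<gamma> unfolding s_def by blast
    then show ?thesis by (auto simp: not_le)
  qed
  have "s \<in> C"
  proof (cases "s \<in> S")
    case False
    then have below: "x < s" if x: "x \<in> S" for x
      using ub x order_le_less[of x s] by blast
    define e where "e = from_nat_into {..<s}"
    have "{..<s} \<noteq> {}" using S below by blast
    then have e: "range e = {..<s}" unfolding e_def using countable by (rule range_from_nat_into)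
    then have e_less: "e n < s" for n by blast
    have "\<exists>\<alpha> :: nat \<Rightarrow> 'k. \<forall>n. (\<alpha> n \<in> S \<and> e n < \<alpha> n) \<and> \<alpha> n < \<alpha> (Suc n)"
    proof (rule dependent_nat_choice)
      show "\<exists>x. x \<in> S \<and> e 0 < x" using least[OF e_less] by blast
      fix x n assume "x \<in> S \<and> e n < x"
      then have "max x (e (Suc n)) < s" using below e_less by simp
      then obtain y where "y \<in> S" "max x (e (Suc n)) < y" using least by blast
      then show "\<exists>y. (y \<in> S \<and> e (Suc n) < y) \<and> x < y" by (intro exI[of _ y]) simp
    qed
    then obtain \<alpha> :: "nat \<Rightarrow> 'k" where \<alpha>: "\<And>n. \<alpha> n \<in> S" "\<And>n. e n < \<alpha> n" "\<And>n. \<alpha> n < \<alpha> (Suc n)"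
      by blast
    have mono: "strict_mono \<alpha>" using \<alpha>(3) by (simp add: strict_mono_Suc_iff)
    have "(LEAST b. \<forall>i. \<alpha> i \<le> b) = s"
    proof (rule least_bound_sequence[OF mono])
      show "\<alpha> i < s" for i using below \<alpha>(1) by blast
      fix \<gamma> assume "\<gamma> < s"
      then obtain n where "\<gamma> = e n" using e by (metis imageE lessThan_iff)
      then show "\<exists>i. \<gamma> < \<alpha> i" using \<alpha>(2) by blast
    qed
    moreover have "range \<alpha> \<subseteq> C" using \<alpha>(1) S by blast
    then have "(LEAST b. \<forall>i. \<alpha> i \<le> b) \<in> C" using C mono unfolding omega_closed_def by blast
    ultimately show ?thesis by simp
  qed (use S in blast)
  then show "(LEAST s. \<forall>x\<in>S. x \<le> s) \<in> C" unfolding s_def .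
qed

lemma subset_NS_eq_subset_NS_omega:
  assumes "\<And>a :: 'k. countable {..<a}"
  shows "subset_NS X (Y :: 'k set) = subset_NS_omega X Y"
proof -
  have "ord_closed C \<longleftrightarrow> omega_closed C" for C :: "'k set"
    using omega_closed_if_ord_closed ord_closed_if_omega_closed assms by blast
  then show ?thesis
    unfolding subset_NS_def subset_NS_omega_def stationary_def omega_stationary_def by simp
qed

end

lemma countable_initial_segment:
  assumes "(ord_rel :: 'k::wellorder rel) =o cardSuc natLeq"
  shows "|{..<a::'k}| \<le>o natLeq"
proof -
  have "Card_order (ord_rel :: 'k rel)"
    using Card_order_ordIso[OF cardSuc_Card_order[OF natLeq_Card_order] assms] .
  from ordLess_ordIso_trans[OF initial_segment_less[OF this] assms] have "|{..<a}| <o cardSuc natLeq" .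
  then show ?thesis
    using cardSuc_ordLeq_ordLess[OF natLeq_Card_order card_of_Card_order[of "{..<a}"]] by simp
qed

text \<open>
  For countable \<open>a\<close>, the continuum hypothesis gives
  \<open>\<omega>\<^sub>1\<^sup>a = (2\<^sup>\<omega>)\<^sup>a = 2\<^sup>\<omega> = \<omega>\<^sub>1\<close>.
\<close>

lemma kappa_if_CH:
  assumes omega_1: "(ord_rel :: 'k::wellorder rel) =o cardSuc natLeq"
    and CH: continuum_hypothesis
  shows "kappa TYPE('k)"
proof
  have card: "Card_order (ord_rel :: 'k rel)"
    using Card_order_ordIso[OF cardSuc_Card_order[OF natLeq_Card_order] omega_1] .
  then show "card_order (ord_rel :: 'k rel)" by (simp add: Field_ord_rel)
  show uncountable: "natLeq <o (ord_rel :: 'k rel)"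
    by (rule ordLess_ordIso_trans[OF cardSuc_greater[OF natLeq_Card_order] ordIso_symmetric[OF omega_1]])
  have inf: "Cinfinite (cardSuc natLeq)" by (rule Cinfinite_cardSuc[OF natLeq_Cinfinite])
  have "regularCard (cardSuc natLeq)"
    by (rule regularCard_cardSuc[OF natLeq_Cinfinite])
  then show "regularCard (ord_rel :: 'k rel)"
    by (rule regularCard_ordIso[OF ordIso_symmetric[OF omega_1] inf])
  have continuum: "(ord_rel :: 'k rel) =o ctwo ^c natLeq"
    by (rule ordIso_transitive[OF omega_1 ordIso_symmetric[OF CH[unfolded continuum_hypothesis_def]]])
  show "small_powers_eq TYPE('k)" unfolding small_powers_eq_def
  proof (intro allI impI)
    fix a :: 'k assume ne: "{..<a} \<noteq> {}"
    let ?r = "ord_rel :: 'k rel" and ?A = "|{..<a}|"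
    have A: "?A \<le>o natLeq" using countable_initial_segment[OF omega_1] .
    have "?r ^c ?A =o (ctwo ^c natLeq) ^c ?A"
      by (rule cexp_cong1[OF continuum card_of_Card_order])
    also have "(ctwo ^c natLeq) ^c ?A =o ctwo ^c (natLeq *c ?A)"
      by (rule cexp_cprod[OF Card_order_ctwo])
    also have "ctwo ^c (natLeq *c ?A) =o ctwo ^c natLeq"
    proof (rule cexp_cong2[OF cprod_infinite1'[OF natLeq_Cinfinite _ A] Card_order_ctwo Card_order_cprod])
      show "Cnotzero ?A"
        using ne by (simp add: card_of_ordIso_czero_iff_empty card_of_Card_order)
    qed
    also have "ctwo ^c natLeq =o ?r" using continuum by (rule ordIso_symmetric)
    finally show "?r ^c ?A =o ?r" .
  qed
qed

theorem corollary14: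
  shows "(card_order (ord_rel :: 'k::wellorder rel) \<and>
          natLeq <o (ord_rel :: 'k rel) \<and>
          regularCard (ord_rel :: 'k rel) \<and>
          small_powers_eq TYPE('k) \<longrightarrow>
          quasiorder_embeds (UNIV :: 'k set set) subset_NS_omega
            (borel_equivs :: ('k \<Rightarrow> bool) rel set) borel_reducible)
       \<and> ((ord_rel :: 'k rel) =o cardSuc natLeq \<and> continuum_hypothesis \<longrightarrow>
          quasiorder_embeds (UNIV :: 'k set set) subset_NS
            (borel_equivs :: ('k \<Rightarrow> bool) rel set) borel_reducible)"
proof (intro conjI impI)
  assume "card_order (ord_rel :: 'k rel) \<and> natLeq <o (ord_rel :: 'k rel) \<and>
    regularCard (ord_rel :: 'k rel) \<and> small_powers_eq TYPE('k)"
  then have "kappa TYPE('k)" by (simp only: kappa_def)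
  then interpret kappa "TYPE('k)" .
  show "quasiorder_embeds (UNIV :: 'k set set) subset_NS_omega
      (borel_equivs :: ('k \<Rightarrow> bool) rel set) borel_reducible"
    by (rule NS_omega_embeds)
next
  assume *: "(ord_rel :: 'k rel) =o cardSuc natLeq \<and> continuum_hypothesis"
  have "kappa TYPE('k)" by (rule kappa_if_CH[OF conjunct1[OF *] conjunct2[OF *]])
  then interpret kappa "TYPE('k)" .
  have "countable {..<a}" for a :: 'k
  proof -
    have "|{..<a}| \<le>o |UNIV :: nat set|"
      by (rule ordLeq_ordIso_trans[OF countable_initial_segment ordIso_symmetric[OF card_of_nat]])
        (use * in blast)
    then obtain h :: "'k \<Rightarrow> nat" where "inj_on h {..<a}"
      unfolding card_of_ordLeq[symmetric] by blast
    then show ?thesis by (rule countableI)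
  qed
  then have "subset_NS = (subset_NS_omega :: 'k set \<Rightarrow> _)"
    by (intro ext subset_NS_eq_subset_NS_omega)
  then show "quasiorder_embeds (UNIV :: 'k set set) subset_NS
      (borel_equivs :: ('k \<Rightarrow> bool) rel set) borel_reducible"
    using NS_omega_embeds by simp
qed

end
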